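(* Let $\alpha_0,\dots,\alpha_4\in\mathbb{C}$ satisfy $\alpha_0+\alpha_1+2\alpha_2+2\alpha_3+2\alpha_4=1$. Consider a polynomial Hamiltonian system $$\frac{dx}{dt}=\frac{\partial H}{\partial y},\quad \frac{dy}{dt}=-\frac{\partial H}{\partial x},\quad \frac{dz}{dt}=\frac{\partial H}{\partial w},\quad \frac{dw}{dt}=-\frac{\partial H}{\partial z}$$ with Hamiltonian $H\in\mathbb{C}(t)[x,y,z,w]$. Assume that (A1) $H$ has degree at most $6$ with respect to $x,y,z,w$; (A2) this system becomes again a polynomial Hamiltonian system in each of the following coordinate systems $(x_i,y_i,z_i,w_i)$, $i=0,1,\dots,4$: $$\begin{aligned} &x_0=1/x,\ y_0=-((y-1)x+\alpha_0)x,\ z_0=z,\ w_0=w,\\ &x_1=1/x,\ y_1=-(yx+\alpha_1)x,\ z_1=z,\ w_1=w,\\ &x_2=-((x-z)y-\alpha_2)y,\ y_2=1/y,\ z_2=z,\ w_2=w+y,\\ &x_3=x,\ y_3=y,\ z_3=1/z,\ w_3=-(wz+\alpha_3)z,\\ &x_4=x,\ y_4=y,\ z_4=z,\ w_4=w-\frac{2\alpha_4}{z}+\frac{t}{z^2}. \end{aligned}$$ Then the system coincides with $$\begin{aligned} \frac{dx}{dt} &=\frac{2x^2y-x^2+(\alpha_0+\alpha_1)x+2\alpha_3z+2z^2w}{t}+1,\\ \frac{dy}{dt} &=\frac{-2xy^2+2xy-(\alpha_0+\alpha_1)y+\alpha_1}{t},\\ \frac{dz}{dt} &=\frac{2z^2w-z^2+(\alpha_0+\alpha_1+2\alpha_2+2\alpha_3)z+2yz^2}{t}+1,\\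 \frac{dw}{dt} &=\frac{-2zw^2+2zw-(\alpha_0+\alpha_1+2\alpha_2+2\alpha_3)w-2\alpha_3y-4yzw+\alpha_3}{t}. \end{aligned}$$
   Context: "The system becomes again a polynomial Hamiltonian system in $(x_i,y_i,z_i,w_i)$" means that, rewritten in these coordinates, it takes the form $dx_i/dt=\partial K_i/\partial y_i$, $dy_i/dt=-\partial K_i/\partial x_i$, $dz_i/dt=\partial K_i/\partial w_i$, $dw_i/dt=-\partial K_i/\partial z_i$ for some $K_i\in\mathbb{C}(t)[x_i,y_i,z_i,w_i]$. *)

theory Defs
  imports "HOL-Library.Poly_Mapping" "HOL-Computational_Algebra.Computational_Algebra"
begin

section \<open>Derivations\<close>

definition derivation :: "('a::comm_ring_1 \<Rightarrow> 'a) \<Rightarrow> bool" where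
  "derivation d \<longleftrightarrow> (\<forall>a b. d (a + b) = d a + d b) \<and> (\<forall>a b. d (a * b) = d a * b + a * d b)"

lemma derivation_add: "derivation d \<Longrightarrow> d (a + b) = d a + d b"
  and derivation_mult: "derivation d \<Longrightarrow> d (a * b) = d a * b + a * d b"
  by (simp_all add: derivation_def)

lemma derivation_0:
  assumes "derivation d" shows "d 0 = 0"
  using derivation_add[OF assms, of 0 0] by simp

text \<open>
  The extension of a derivation of an integral domain to its field of fractions by the quotient
  rule.  For a derivation the value does not depend on the representing fraction,
  see \<open>fract_diff_Fract\<close> below.
\<close>

definition fract_diff :: "('a::idom \<Rightarrow> 'a) \<Rightarrow> 'a fract \<Rightarrow> 'a fract" where
  "fract_diff d q =
     (SOME r. \<exists>a b. b \<noteq> 0 \<and> q = Fract a b \<and> r = Fract (d a * b - a * d b) (b\<^sup>2))"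

lemma fract_diff_Fract:
  assumes d: "derivation d" and b: "b \<noteq> 0"
  shows "fract_diff d (Fract a b) = Fract (d a * b - a * d b) (b\<^sup>2)"
  unfolding fract_diff_def
proof (rule someI2)
  show "\<exists>a' b'. b' \<noteq> 0 \<and> Fract a b = Fract a' b' \<and>
          Fract (d a * b - a * d b) (b\<^sup>2) = Fract (d a' * b' - a' * d b') (b'\<^sup>2)"
    using b by blast
next
  fix r assume "\<exists>a' b'. b' \<noteq> 0 \<and> Fract a b = Fract a' b' \<and> r = Fract (d a' * b' - a' * d b') (b'\<^sup>2)"
  then obtain a' b' where b': "b' \<noteq> 0" and eq: "Fract a b = Fract a' b'"
    and r: "r = Fract (d a' * b' - a' * d b') (b'\<^sup>2)" by blast
  have e: "a * b' = a' * b" using eq b b' by (simp add: eq_fract)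
  then have "d (a * b') = d (a' * b)" by simp
  then have e': "d a * b' + a * d b' = d a' * b + a' * d b"
    by (simp add: derivation_mult[OF d])
  have "(d a' * b' - a' * d b') * b\<^sup>2 = (d a * b - a * d b) * b'\<^sup>2"
    using e e' by algebra
  then show "r = Fract (d a * b - a * d b) (b\<^sup>2)"
    using b b' by (simp add: r eq_fract)
qed

lemma derivation_fract_diff:
  assumes d: "derivation d" shows "derivation (fract_diff d)"
  unfolding derivation_def
proof (intro conjI allI)
  fix p q :: "'a fract"
  obtain a b where p: "p = Fract a b" "b \<noteq> 0" by (cases p)
  obtain a' b' where q: "q = Fract a' b'" "b' \<noteq> 0" by (cases q)
  note s = derivation_add[OF d] derivation_mult[OF d] fract_diff_Fract[OF d] eq_fract
  show "fract_diff d (p + q) = fract_diff d p + fract_diff d q"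
    using p q by (simp add: s power2_eq_square algebra_simps)
  show "fract_diff d (p * q) = fract_diff d p * q + p * fract_diff d q"
    using p q by (simp add: s power2_eq_square algebra_simps)
qed

lemma derivation_pderiv: "derivation (pderiv :: 'a::idom poly \<Rightarrow> 'a poly)"
  by (simp add: derivation_def pderiv_add pderiv_mult algebra_simps)


section \<open>Polynomials in several variables\<close>

text \<open>
  A polynomial over \<open>'a\<close> with variables indexed by \<open>'v\<close> is a finitely supported map from exponent
  vectors \<open>'v \<Rightarrow>\<^sub>0 nat\<close> to coefficients; multiplication on this type is convolution.
\<close>

type_synonym ('v, 'a) mpoly = "('v \<Rightarrow>\<^sub>0 nat) \<Rightarrow>\<^sub>0 'a"

definition total_degree :: "('v::finite, 'a::zero) mpoly \<Rightarrow> nat" where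
  "total_degree p =
     Max (insert 0 ((\<lambda>m. \<Sum>v\<in>UNIV. Poly_Mapping.lookup m v) ` Poly_Mapping.keys p))"

definition mpderiv :: "'v \<Rightarrow> ('v, 'a::comm_ring_1) mpoly \<Rightarrow> ('v, 'a) mpoly" where
  "mpderiv v p = (\<Sum>m\<in>Poly_Mapping.keys p.
     Poly_Mapping.single (m - Poly_Mapping.single v 1)
       (of_nat (Poly_Mapping.lookup m v) * Poly_Mapping.lookup p m))"

definition coeff_diff :: "('a::comm_ring_1 \<Rightarrow> 'a) \<Rightarrow> ('v, 'a) mpoly \<Rightarrow> ('v, 'a) mpoly" where
  "coeff_diff d p = Poly_Mapping.map d p"

lemma lookup_mpderiv:
  "Poly_Mapping.lookup (mpderiv v p) m =
     of_nat (Suc (Poly_Mapping.lookup m v)) * Poly_Mapping.lookup p (m + Poly_Mapping.single v 1)"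
proof -
  have eq: "(of_nat (Poly_Mapping.lookup k v) * Poly_Mapping.lookup p k
               when k - Poly_Mapping.single v 1 = m)
          = (if k = m + Poly_Mapping.single v 1
             then of_nat (Poly_Mapping.lookup k v) * Poly_Mapping.lookup p k else 0)" for k
  proof (cases "Poly_Mapping.lookup k v = 0")
    case False
    then have "k - Poly_Mapping.single v 1 = m \<longleftrightarrow> k = m + Poly_Mapping.single v 1"
      by (auto simp: poly_mapping_eq_iff fun_eq_iff lookup_minus lookup_add lookup_single when_def)
    then show ?thesis by (simp add: when_def)
  qed (auto simp: when_def)
  show ?thesis
    by (simp add: mpderiv_def lookup_sum lookup_single eq sum.delta in_keys_iff
        lookup_add add.commute[of 1] del: One_nat_def)
qed

lemma derivation_if_monomials:
  fixes D :: "('v, 'a::comm_ring_1) mpoly \<Rightarrow> ('v, 'a) mpoly"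
  assumes add: "\<And>p q. D (p + q) = D p + D q"
    and mon: "\<And>m n a b. D (Poly_Mapping.single m a * Poly_Mapping.single n b) =
       D (Poly_Mapping.single m a) * Poly_Mapping.single n b
       + Poly_Mapping.single m a * D (Poly_Mapping.single n b)"
  shows "derivation D"
proof -
  have D0: "D 0 = 0" using add[of 0 0] by simp
  have step: "Poly_Mapping.update k c p = p + Poly_Mapping.single k c"
    if "k \<notin> Poly_Mapping.keys p" for k c and p :: "('v, 'a) mpoly"
    using that by (intro poly_mapping_eqI)
      (auto simp: lookup_update lookup_add lookup_single when_def in_keys_iff)
  have 1: "D (Poly_Mapping.single m a * q) =
      D (Poly_Mapping.single m a) * q + Poly_Mapping.single m a * D q" for m a q
  proof (induction q rule: update_induct)
    case const
    then show ?case by (simp add: D0)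
  next
    case (update q k c)
    then show ?case by (simp add: step mon add algebra_simps)
  qed
  have "D (p * q) = D p * q + p * D q" for p q
  proof (induction p rule: update_induct)
    case const
    then show ?case by (simp add: D0)
  next
    case (update p k c)
    then show ?case by (simp add: step 1 add distrib_left distrib_right)
  qed
  then show ?thesis by (simp add: derivation_def add)
qed

lemma mpderiv_single:
  "mpderiv v (Poly_Mapping.single m a) =
     Poly_Mapping.single (m - Poly_Mapping.single v 1) (of_nat (Poly_Mapping.lookup m v) * a)"
  by (cases "a = 0") (simp_all add: mpderiv_def)

lemma derivation_mpderiv: "derivation (mpderiv v :: ('v, 'a::comm_ring_1) mpoly \<Rightarrow> _)"
proof (rule derivation_if_monomials)
  fix p q :: "('v, 'a) mpoly"
  show "mpderiv v (p + q) = mpderiv v p + mpderiv v q"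
    by (rule poly_mapping_eqI) (simp add: lookup_mpderiv lookup_add algebra_simps)
next
  fix m n :: "'v \<Rightarrow>\<^sub>0 nat" and a b :: 'a
  have shift: "k - Poly_Mapping.single v 1 + l = k + l - Poly_Mapping.single v 1"
    if "Poly_Mapping.lookup k v \<noteq> 0" for k l :: "'v \<Rightarrow>\<^sub>0 nat"
    using that by (intro poly_mapping_eqI)
      (auto simp: lookup_minus lookup_add lookup_single when_def)
  have 1: "Poly_Mapping.single (m - Poly_Mapping.single v 1 + n) (of_nat (Poly_Mapping.lookup m v) * a * b)
      = Poly_Mapping.single (m + n - Poly_Mapping.single v 1) (of_nat (Poly_Mapping.lookup m v) * a * b)"
    by (cases "Poly_Mapping.lookup m v = 0") (simp_all add: shift del: One_nat_def)
  have 2: "Poly_Mapping.single (m + (n - Poly_Mapping.single v 1)) (a * (of_nat (Poly_Mapping.lookup n v) * b))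
      = Poly_Mapping.single (m + n - Poly_Mapping.single v 1) (a * (of_nat (Poly_Mapping.lookup n v) * b))"
    using shift[of n m]
    by (cases "Poly_Mapping.lookup n v = 0") (simp_all add: add.commute del: One_nat_def)
  show "mpderiv v (Poly_Mapping.single m a * Poly_Mapping.single n b) =
      mpderiv v (Poly_Mapping.single m a) * Poly_Mapping.single n b
      + Poly_Mapping.single m a * mpderiv v (Poly_Mapping.single n b)"
    unfolding mpderiv_single mult_single 1 2
    by (simp add: lookup_add algebra_simps flip: single_add)
qed

lemma derivation_coeff_diff:
  assumes d: "derivation d"
  shows "derivation (coeff_diff d :: ('v, 'a::comm_ring_1) mpoly \<Rightarrow> _)"
proof (rule derivation_if_monomials)
  have l: "Poly_Mapping.lookup (coeff_diff d p) m = d (Poly_Mapping.lookup p m)"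
    for p :: "('v, 'a) mpoly" and m
    by (simp add: coeff_diff_def Poly_Mapping.map.rep_eq when_def derivation_0[OF d])
  show "coeff_diff d (p + q) = coeff_diff d p + coeff_diff d q" for p q :: "('v, 'a) mpoly"
    by (rule poly_mapping_eqI) (simp add: l lookup_add derivation_add[OF d])
  have s: "coeff_diff d (Poly_Mapping.single m a) = Poly_Mapping.single m (d a)"
    for m :: "'v \<Rightarrow>\<^sub>0 nat" and a
    by (rule poly_mapping_eqI) (simp add: l lookup_single when_def derivation_0[OF d])
  show "coeff_diff d (Poly_Mapping.single m a * Poly_Mapping.single n b) =
      coeff_diff d (Poly_Mapping.single m a) * Poly_Mapping.single n b
      + Poly_Mapping.single m a * coeff_diff d (Poly_Mapping.single n b)"
    for m n :: "'v \<Rightarrow>\<^sub>0 nat" and a b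
    by (simp add: mult_single s derivation_mult[OF d] flip: single_add)
qed


section \<open>The rings \<open>\<complex>(t)\<close>, \<open>\<complex>(t)[x,y,z,w]\<close> and \<open>\<complex>(t)(x,y,z,w)\<close>\<close>

datatype coord = CX | CY | CZ | CW

text \<open>The order on the variables plays no role in the mathematics; the library asks for it in order
  to make the polynomial ring an instance of \<^class>\<open>idom\<close>.\<close>

fun coord_index :: "coord \<Rightarrow> nat" where
  "coord_index CX = 0" | "coord_index CY = 1" | "coord_index CZ = 2" | "coord_index CW = 3"

instantiation coord :: linorder
begin
definition less_eq_coord where "a \<le> b \<longleftrightarrow> coord_index a \<le> coord_index b"
definition less_coord where "a < b \<longleftrightarrow> coord_index a < coord_index b"
instance
proof
  fix a b :: coord
  show "a \<le> b \<Longrightarrow> b \<le> a \<Longrightarrow> a = b"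
    by (cases a; cases b) (simp_all add: less_eq_coord_def)
qed (auto simp: less_eq_coord_def less_coord_def)
end

lemma UNIV_coord: "UNIV = {CX, CY, CZ, CW}"
  using coord.exhaust by auto

instance coord :: finite
  by standard (simp add: UNIV_coord)

type_synonym Ct = "complex poly fract"
type_synonym hpoly = "(coord, Ct) mpoly"
type_synonym hrat = "hpoly fract"

definition coef :: "Ct \<Rightarrow> hrat" where
  "coef c = to_fract (Poly_Mapping.single 0 c)"

definition C :: "complex \<Rightarrow> hrat" where
  "C c = coef (to_fract [:c:])"

definition T :: hrat where
  "T = coef (to_fract [:0, 1:])"

definition gen :: "coord \<Rightarrow> hrat" where
  "gen v = to_fract (Poly_Mapping.single (Poly_Mapping.single v 1) 1)"

abbreviation X :: hrat where "X \<equiv> gen CX"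
abbreviation Y :: hrat where "Y \<equiv> gen CY"
abbreviation Z :: hrat where "Z \<equiv> gen CZ"
abbreviation W :: hrat where "W \<equiv> gen CW"

text \<open>\<open>psubst g K\<close> is \<open>K(g CX, g CY, g CZ, g CW)\<close>, with the coefficients in \<open>\<complex>(t)\<close> unchanged.\<close>

definition psubst :: "(coord \<Rightarrow> hrat) \<Rightarrow> hpoly \<Rightarrow> hrat" where
  "psubst g K = (\<Sum>m\<in>Poly_Mapping.keys K.
     coef (Poly_Mapping.lookup K m) * (\<Prod>v\<in>UNIV. g v ^ Poly_Mapping.lookup m v))"

definition partial :: "coord \<Rightarrow> hrat \<Rightarrow> hrat" where
  "partial v = fract_diff (mpderiv v)"

text \<open>The explicit \<open>t\<close>-derivative, with \<open>x, y, z, w\<close> held fixed.\<close>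

definition partial_t :: "hrat \<Rightarrow> hrat" where
  "partial_t = fract_diff (coeff_diff (fract_diff pderiv))"


section \<open>Hamiltonian systems and changes of coordinates\<close>

text \<open>
  The total derivative \<open>df/dt\<close> of a rational function \<open>f\<close> of \<open>t, x, y, z, w\<close> along the system
  \<open>dx/dt = \<partial>H/\<partial>y\<close>, \<open>dy/dt = -\<partial>H/\<partial>x\<close>, \<open>dz/dt = \<partial>H/\<partial>w\<close>, \<open>dw/dt = -\<partial>H/\<partial>z\<close> (chain rule).
\<close>

definition flow_diff :: "hpoly \<Rightarrow> hrat \<Rightarrow> hrat" where
  "flow_diff H f = partial_t f
     + to_fract (mpderiv CY H) * partial CX f - to_fract (mpderiv CX H) * partial CY f
     + to_fract (mpderiv CW H) * partial CZ f - to_fract (mpderiv CZ H) * partial CW f"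

text \<open>
  Rewritten in the coordinates \<open>x', y', z', w'\<close>, given as rational functions of \<open>t, x, y, z, w\<close>, the
  system with Hamiltonian \<open>H\<close> is the Hamiltonian system of some \<open>K \<in> \<complex>(t)[x',y',z',w']\<close>.  The
  equations are identities in \<open>\<complex>(t)(x,y,z,w)\<close>, and \<open>K\<close> need not be \<open>H\<close> expressed in the new
  coordinates, since these may depend on \<open>t\<close>.
\<close>

definition becomes_polynomial_Hamiltonian ::
    "hpoly \<Rightarrow> hrat \<Rightarrow> hrat \<Rightarrow> hrat \<Rightarrow> hrat \<Rightarrow> bool" where
  "becomes_polynomial_Hamiltonian H x' y' z' w' \<longleftrightarrow>
     (\<exists>K :: hpoly.
        let s = psubst (\<lambda>v. case v of CX \<Rightarrow> x' | CY \<Rightarrow> y' | CZ \<Rightarrow> z' | CW \<Rightarrow> w') in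
          flow_diff H x' = s (mpderiv CY K) \<and> flow_diff H y' = - s (mpderiv CX K) \<and>
          flow_diff H z' = s (mpderiv CW K) \<and> flow_diff H w' = - s (mpderiv CZ K))"

end

theory Submission
  imports Defs
begin

text \<open>
  For constant \<open>t\<close> each of the five coordinate changes is symplectic.  Hence a polynomial Hamiltonian \<open>K\<close>
  in the new coordinates, rewritten in the old ones, has the same gradient as \<open>H\<close>, up to the
  contribution of the explicit \<open>t\<close>-dependence of the change, which is nonzero only in the last chart, where it is the
  gradient of \<open>1 / z\<close>.  A rational function with vanishing gradient lies in \<open>\<complex>(t)\<close>.  So the
  hypothesis says that \<open>H\<close> (in the last chart \<open>H + 1 / z\<close>) is a polynomial in each of the
  five coordinate systems: \<open>hamiltonian_in_chart_0\<close> to \<open>hamiltonian_in_chart_4\<close>.  These statements are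
  made about the values of \<open>H\<close> at points of \<open>\<complex>(t)\<^sup>4\<close>; the field \<open>\<complex>(t)\<close> is
  infinite, so that a polynomial is determined by its values.  What remains is linear algebra
  on the coefficients of \<open>H\<close>.

  The first four charts have one shape, \<open>(x, y) \<mapsto> (1 / x, - (y x + \<alpha>) x)\<close>, after a translation or an
  exchange of the variables.  Give \<open>x\<close> the weight \<open>1\<close> and \<open>y\<close> the weight \<open>-1\<close> and put \<open>u = x y\<close>.  The part
  of weight \<open>k > 0\<close> of a polynomial is \<open>x ^ k p(u)\<close>, and it is a polynomial in the new coordinates only
  if \<open>(u + \<alpha>) ^ k\<close> divides \<open>p\<close> (\<open>chart_regular_dvd\<close>).  Since the degree is at most \<open>6\<close>, there is no
  part of weight three or more, and the parts of weight one and two satisfy a few linear relations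
  (\<open>chart_regular_degree6\<close>).

  In the charts \<open>0\<close> and \<open>1\<close> the values \<open>1\<close> and \<open>0\<close> of \<open>y\<close> play the same part, and the two sets of
  relations together bound the degree in \<open>x\<close> by two (\<open>two_shifted_charts\<close>).  The last chart has a pole
  of order two in \<open>z\<close>, which bounds the degree in \<open>w\<close> by two (\<open>pole_chart_degree6\<close>).  With chart \<open>3\<close> this
  leaves the polynomials \<open>normal_form\<close> with finitely many constants.  Chart \<open>2\<close> couples the two pairs of
  variables: apart from the additive constant, it makes all of them zero or multiples of a single one, called \<open>s0\<close>,
  and finally gives
  \<open>(\<alpha>0 + \<alpha>1 + 2 \<alpha>2 + 2 \<alpha>3 + 2 \<alpha>4) s0 = 1 / t\<close> (\<open>normal_form_unique\<close>).  The right-hand side comes from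
  the correction \<open>1 / z\<close>, and the normalization of the parameters makes \<open>s0 = 1 / t\<close> for all their values.
\<close>

section \<open>Derivations of the field of rational functions\<close>

instance fract :: ("{idom,ring_char_0}") ring_char_0
proof
  have "of_nat n = to_fract (of_nat n :: 'a)" for n by (induction n) simp_all
  then show "inj (of_nat :: nat \<Rightarrow> 'a fract)" by (auto intro!: injI)
qed

lemma derivation_1: "derivation d \<Longrightarrow> d 1 = 0"
  using derivation_mult[of d 1 1] by (metis add_cancel_left_right mult_1_left mult_1_right)

context
  fixes d :: "'a::field \<Rightarrow> 'a"
  assumes d: "derivation d"
begin

lemma derivation_uminus: "d (- a) = - d a"
  using derivation_add[OF d, of a "- a"] derivation_0[OF d] by (simp add: eq_neg_iff_add_eq_0 add.commute)

lemma derivation_diff: "d (a - b) = d a - d b"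
  using derivation_add[OF d, of a "- b"] by (simp add: derivation_uminus)

lemma derivation_numeral: "d (numeral n) = 0"
proof -
  have "d (of_nat k) = 0" for k
    by (induction k) (simp_all add: derivation_0[OF d] derivation_add[OF d] derivation_1[OF d])
  from this[of "numeral n"] show ?thesis by simp
qed

lemma derivation_power: "d (a ^ n) = of_nat n * a ^ (n - 1) * d a"
proof (induction n)
  case (Suc n)
  then show ?case by (cases n) (simp_all add: derivation_mult[OF d] algebra_simps)
qed (simp add: derivation_1[OF d])

lemma derivation_divide: "b \<noteq> 0 \<Longrightarrow> d (a / b) = (d a * b - a * d b) / b\<^sup>2"
  using derivation_mult[OF d, of "a / b" b] by (simp add: field_simps power2_eq_square)

lemmas derivation_simps = derivation_0[OF d] derivation_1[OF d] derivation_add[OF d] derivation_uminus derivation_diff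
  derivation_mult[OF d] derivation_numeral derivation_power derivation_divide

end

lemma fract_diff_to_fract:
  assumes "derivation d" shows "fract_diff d (to_fract a) = to_fract (d a)"
  using fract_diff_Fract[OF assms, of 1 a] by (simp add: to_fract_def derivation_1[OF assms])

lemma partial_to_fract: "partial v (to_fract P) = to_fract (mpderiv v P)"
  unfolding partial_def by (rule fract_diff_to_fract[OF derivation_mpderiv])

lemma derivation_partial: "derivation (partial v)"
  unfolding partial_def by (intro derivation_fract_diff derivation_mpderiv)

lemma partial_coef: "partial v (coef c) = 0"
  by (simp add: coef_def partial_to_fract mpderiv_single)

lemma partial_gen: "partial v (gen u) = (if u = v then 1 else 0)"
  by (simp add: gen_def partial_to_fract mpderiv_single lookup_single)

lemma derivation_partial_t: "derivation partial_t"
  unfolding partial_t_def by (intro derivation_fract_diff derivation_coeff_diff derivation_pderiv)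

lemma coeff_diff_single:
  assumes "d 0 = 0" shows "coeff_diff d (Poly_Mapping.single m a) = Poly_Mapping.single m (d a)"
  using assms unfolding coeff_diff_def by (intro poly_mapping_eqI)
   (simp add: Poly_Mapping.map.rep_eq lookup_single when_def)

lemma partial_t_coef: "partial_t (coef c) = coef (fract_diff pderiv c)"
  unfolding partial_t_def coef_def
  by (simp add: fract_diff_to_fract derivation_coeff_diff derivation_fract_diff derivation_pderiv
      coeff_diff_single derivation_0)

lemma partial_t_gen: "partial_t (gen v) = 0"
proof -
  have "fract_diff pderiv (1 :: Ct) = 0"
    using derivation_1[OF derivation_fract_diff[OF derivation_pderiv]] .
  then show ?thesis unfolding partial_t_def gen_def
    by (simp add: fract_diff_to_fract derivation_coeff_diff derivation_fract_diff derivation_pderiv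
      coeff_diff_single derivation_0)
qed

lemma coef_hom: "coef 0 = 0" "coef 1 = 1" "coef (a + b) = coef a + coef b" "coef (a * b) = coef a * coef b"
  by (simp_all add: coef_def single_add mult_single flip: to_fract_add to_fract_mult)

lemma coef_diff: "coef (a - b) = coef a - coef b"
  using coef_hom(3)[of "a - b" b] by simp

lemma to_fract_constant_1: "to_fract [:1:] = 1"
  by (simp flip: one_pCons)

lemma partial_t_C: "partial_t (C c) = 0"
  by (simp add: C_def partial_t_coef fract_diff_to_fract derivation_pderiv pderiv_pCons coef_hom)

lemma partial_t_T: "partial_t T = 1"
  by (simp add: T_def partial_t_coef fract_diff_to_fract derivation_pderiv pderiv_pCons coef_hom to_fract_constant_1)

lemma partial_C: "partial v (C c) = 0" and partial_T: "partial v T = 0"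
  by (simp_all add: C_def T_def partial_coef)

lemma gen_nonzero: "gen v \<noteq> 0"
proof -
  have "Poly_Mapping.lookup (Poly_Mapping.single (Poly_Mapping.single v 1) (1 :: Ct)) (Poly_Mapping.single v 1) \<noteq> 0"
    by simp
  then show ?thesis unfolding gen_def to_fract_eq_0_iff by (metis lookup_zero)
qed

section \<open>Substitution and the chain rule\<close>

definition eval_mpoly :: "('a::comm_ring_1 \<Rightarrow> 'b::comm_ring_1) \<Rightarrow> ('v::finite \<Rightarrow> 'b) \<Rightarrow> ('v, 'a) mpoly \<Rightarrow> 'b" where
  "eval_mpoly \<phi> g K = (\<Sum>m\<in>Poly_Mapping.keys K.
     \<phi> (Poly_Mapping.lookup K m) * (\<Prod>v\<in>UNIV. g v ^ Poly_Mapping.lookup m v))"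

lemma psubst_eq_eval: "psubst g K = eval_mpoly coef g K"
  by (simp add: psubst_def eval_mpoly_def)

lemma eval_mpoly_superset:
  assumes "finite S" "Poly_Mapping.keys K \<subseteq> S" "\<phi> 0 = 0"
  shows "eval_mpoly \<phi> g K = (\<Sum>m\<in>S. \<phi> (Poly_Mapping.lookup K m) * (\<Prod>v\<in>UNIV. g v ^ Poly_Mapping.lookup m v))"
  unfolding eval_mpoly_def
  by (rule sum.mono_neutral_left) (use assms in \<open>auto simp: in_keys_iff\<close>)

lemma mpoly_induct [case_names 0 add]:
  fixes p :: "('v, 'a::comm_ring_1) mpoly"
  assumes "P 0" and "\<And>p k c. P p \<Longrightarrow> P (p + Poly_Mapping.single k c)"
  shows "P p"
proof (induction p rule: update_induct)
  case const
  then show ?case by (rule assms(1))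
next
  case (update p k c)
  have "Poly_Mapping.update k c p = p + Poly_Mapping.single k c"
    using update by (intro poly_mapping_eqI)
      (auto simp: lookup_update lookup_add lookup_single when_def in_keys_iff)
  then show ?case using update assms(2) by simp
qed

lemma eval_mpoly_add:
  assumes "\<phi> 0 = 0" "\<And>a b. \<phi> (a + b) = \<phi> a + \<phi> b"
  shows "eval_mpoly \<phi> g (p + q) = eval_mpoly \<phi> g p + eval_mpoly \<phi> g q"
proof -
  let ?S = "Poly_Mapping.keys p \<union> Poly_Mapping.keys q"
  have "Poly_Mapping.keys (p + q) \<subseteq> ?S" by (rule keys_add)
  then show ?thesis
    using eval_mpoly_superset[of ?S p \<phi> g] eval_mpoly_superset[of ?S q \<phi> g]
      eval_mpoly_superset[of ?S "p + q" \<phi> g] assms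
    by (simp add: lookup_add distrib_right sum.distrib)
qed

lemma eval_mpoly_single:
  assumes "\<phi> 0 = 0"
  shows "eval_mpoly \<phi> g (Poly_Mapping.single m c) = \<phi> c * (\<Prod>v\<in>UNIV. g v ^ Poly_Mapping.lookup m v)"
  using eval_mpoly_superset[of "{m}" "Poly_Mapping.single m c" \<phi> g] assms by simp

lemma eval_mpoly_mult:
  fixes p q :: "('v::finite, 'a::comm_ring_1) mpoly"
  assumes \<phi>: "\<phi> 0 = 0" "\<And>a b. \<phi> (a + b) = \<phi> a + \<phi> b" "\<And>a b. \<phi> (a * b) = \<phi> a * \<phi> b"
  shows "eval_mpoly \<phi> g (p * q) = eval_mpoly \<phi> g p * eval_mpoly \<phi> g q"
proof -
  note s = eval_mpoly_add[of \<phi>, OF \<phi>(1,2)] eval_mpoly_single[of \<phi>, OF \<phi>(1)]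
  have 0: "eval_mpoly \<phi> g 0 = 0" by (simp add: eval_mpoly_def)
  have "eval_mpoly \<phi> g (Poly_Mapping.single m c * q) = eval_mpoly \<phi> g (Poly_Mapping.single m c) * eval_mpoly \<phi> g q" for m c
  proof (induction q rule: mpoly_induct)
    case (add q k b)
    then show ?case
      by (simp add: s distrib_left mult_single \<phi> lookup_add power_add prod.distrib mult_ac)
  qed (simp add: 0)
  then show ?thesis
    by (induction p rule: mpoly_induct) (simp_all add: 0 s distrib_right)
qed

text \<open>
  The chain rule: both sides are additive in \<open>K\<close>, and for a monomial it is the product rule.
\<close>

lemma derivation_psubst:
  assumes d: "derivation d" and coef: "\<And>c. d (coef c) = 0"
  shows "d (psubst g K) = (\<Sum>v\<in>UNIV. psubst g (mpderiv v K) * d (g v))"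
proof (induction K rule: mpoly_induct)
  case 0
  then show ?case by (simp add: psubst_def mpderiv_def derivation_0[OF d])
next
  case (add K m c)
  note s = eval_mpoly_add[of coef, OF coef_hom(1,3)] eval_mpoly_single[of coef, OF coef_hom(1)]
  have of_nat: "coef (of_nat n) = of_nat n" for n by (induction n) (simp_all add: coef_hom)
  have lk: "Poly_Mapping.lookup (m - Poly_Mapping.single v 1) u = (if u = v then Poly_Mapping.lookup m u - 1 else Poly_Mapping.lookup m u)" for u v
    by (simp add: lookup_minus lookup_single when_def)
  have "d (coef c * (\<Prod>v\<in>UNIV. g v ^ Poly_Mapping.lookup m v))
     = (\<Sum>v\<in>UNIV. psubst g (mpderiv v (Poly_Mapping.single m c)) * d (g v))"
    unfolding psubst_eq_eval mpderiv_single s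
    by (simp add: UNIV_coord lk lk[unfolded One_nat_def] coef_hom of_nat derivation_mult[OF d] derivation_power[OF d] coef algebra_simps)
  then show ?case
    using add by (simp add: psubst_eq_eval s derivation_add[OF derivation_mpderiv] derivation_add[OF d] distrib_right sum.distrib)
qed

section \<open>Rational functions with a monomial denominator\<close>

lemma gen_power: "gen v ^ n = to_fract (Poly_Mapping.single (Poly_Mapping.single v n) 1)"
  by (induction n) (simp_all add: gen_def mult_single flip: to_fract_mult single_add)

lemma lookup_of_nat_mult:
  fixes P :: "('v, 'a::comm_ring_1) mpoly"
  shows "Poly_Mapping.lookup (of_nat N * P) m = of_nat N * Poly_Mapping.lookup P m"
  by (induction N) (simp_all add: distrib_right lookup_add)

text \<open>
  The operator \<open>v \<partial>/\<partial>v\<close> is diagonal on monomials, its eigenvalue being the exponent of \<open>v\<close>.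
\<close>

lemma lookup_euler:
  fixes P :: "('v, 'a::comm_ring_1) mpoly"
  shows "Poly_Mapping.lookup (Poly_Mapping.single (Poly_Mapping.single v 1) 1 * mpderiv v P) m
    = of_nat (Poly_Mapping.lookup m v) * Poly_Mapping.lookup P m"
proof (induction P rule: mpoly_induct)
  case 0
  then show ?case by (simp add: mpderiv_def)
next
  case (add P k c)
  have "Poly_Mapping.single v 1 + (k - Poly_Mapping.single v 1) = k" if "Poly_Mapping.lookup k v \<noteq> 0"
    using that by (intro poly_mapping_eqI) (auto simp: lookup_add lookup_minus lookup_single when_def)
  then have "Poly_Mapping.single (Poly_Mapping.single v 1) 1 * mpderiv v (Poly_Mapping.single k c)
    = Poly_Mapping.single k (of_nat (Poly_Mapping.lookup k v) * c)"
    by (cases "Poly_Mapping.lookup k v = 0") (simp_all add: mpderiv_single mult_single)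
  then show ?case
    using add by (simp add: derivation_add[OF derivation_mpderiv] distrib_left lookup_add lookup_single when_def)
qed

text \<open>
  Each chart has denominators in a single variable \<open>v\<close> only, so that all functions to be compared lie in
  this localization of the polynomial ring.
\<close>

definition laurent :: "coord \<Rightarrow> hrat \<Rightarrow> bool" where
  "laurent v f \<longleftrightarrow> (\<exists>N P. f * gen v ^ N = to_fract P)"

text \<open>
  Write \<open>f = P / v ^ N\<close>.  No variable other than \<open>v\<close> occurs in \<open>P\<close>, and \<open>v \<partial>P/\<partial>v = N P\<close> by Euler's
  formula, so that \<open>v ^ N\<close> is the only monomial of \<open>P\<close>.
\<close>

lemma laurent_constant:
  assumes f: "laurent v f" and partial: "\<And>u. partial u f = 0"
  shows "\<exists>c. f = coef c"
proof -
  obtain N P where P: "f * gen v ^ N = to_fract P" using f by (auto simp: laurent_def)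
  have d: "to_fract (mpderiv u P) = f * partial u (gen v ^ N)" for u
    unfolding partial_to_fract[symmetric] P[symmetric]
    by (simp add: derivation_mult[OF derivation_partial] partial)
  have other: "mpderiv u P = 0" if "u \<noteq> v" for u
    using d[of u] that by (simp add: derivation_power[OF derivation_partial] partial_gen)
  have "to_fract (Poly_Mapping.single (Poly_Mapping.single v 1) 1 * mpderiv v P) = to_fract (of_nat N * P)"
  proof -
    have of_nat: "to_fract (of_nat n :: hpoly) = of_nat n" for n by (induction n) simp_all
    have "gen v * to_fract (mpderiv v P) = of_nat N * (f * gen v ^ N)"
      unfolding d derivation_power[OF derivation_partial] by (cases N) (simp_all add: partial_gen)
    then show ?thesis unfolding P unfolding to_fract_mult of_nat gen_def .
  qed
  then have self: "Poly_Mapping.single (Poly_Mapping.single v 1) 1 * mpderiv v P = of_nat N * P"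
    unfolding to_fract_eq_iff .
  have key: "m = Poly_Mapping.single v N" if "Poly_Mapping.lookup P m \<noteq> 0" for m
  proof (intro poly_mapping_eqI)
    fix u
    show "Poly_Mapping.lookup m u = Poly_Mapping.lookup (Poly_Mapping.single v N) u"
    proof (cases "u = v")
      case True
      have "of_nat (Poly_Mapping.lookup m v) * Poly_Mapping.lookup P m = of_nat N * Poly_Mapping.lookup P m"
        using arg_cong[OF self, of "\<lambda>Q. Poly_Mapping.lookup Q m"] unfolding lookup_euler lookup_of_nat_mult .
      then show ?thesis using True that by simp
    next
      case False
      have "of_nat (Poly_Mapping.lookup m u) * Poly_Mapping.lookup P m = 0"
        using lookup_euler[of u P m] other[OF False] by simp
      then show ?thesis using False that by (simp add: lookup_single)
    qed
  qed
  have "P = Poly_Mapping.single (Poly_Mapping.single v N) (Poly_Mapping.lookup P (Poly_Mapping.single v N))"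
    by (intro poly_mapping_eqI) (use key in \<open>auto simp: lookup_single when_def\<close>)
  also have "\<dots> = Poly_Mapping.single 0 (Poly_Mapping.lookup P (Poly_Mapping.single v N)) * Poly_Mapping.single (Poly_Mapping.single v N) 1"
    by (simp add: mult_single)
  finally have "f * gen v ^ N = coef (Poly_Mapping.lookup P (Poly_Mapping.single v N)) * gen v ^ N"
    unfolding P unfolding gen_power coef_def to_fract_mult[symmetric] to_fract_eq_iff .
  then show ?thesis using gen_nonzero[of v] by auto
qed

lemma laurent_to_fract: "laurent v (to_fract P)"
  unfolding laurent_def by (intro exI[of _ 0] exI[of _ P]) simp

lemma laurent_gen: "laurent v (gen u)" and laurent_coef: "laurent v (coef c)"
  unfolding gen_def coef_def by (rule laurent_to_fract)+

lemma laurent_C: "laurent v (C c)" and laurent_T: "laurent v T"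
  unfolding C_def T_def by (rule laurent_coef)+

lemma laurent_1: "laurent v 1" using laurent_to_fract[of v 1] by simp
lemma laurent_numeral: "laurent v (numeral n)"
proof -
  have "to_fract (of_nat n :: hpoly) = of_nat n" for n by (induction n) simp_all
  from this[of "numeral n"] show ?thesis
    unfolding of_nat_numeral using laurent_to_fract[of v "numeral n"] by simp
qed

lemma laurent_add:
  assumes "laurent v f" "laurent v g" shows "laurent v (f + g)"
proof -
  obtain N P M Q where e: "f * gen v ^ N = to_fract P" "g * gen v ^ M = to_fract Q"
    using assms by (auto simp: laurent_def)
  have "(f + g) * gen v ^ (N + M) = to_fract (P * Poly_Mapping.single (Poly_Mapping.single v M) 1
      + Q * Poly_Mapping.single (Poly_Mapping.single v N) 1)"
    unfolding to_fract_add to_fract_mult gen_power[symmetric] e[symmetric] by (simp add: algebra_simps power_add)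
  then show ?thesis unfolding laurent_def by blast
qed

lemma laurent_mult:
  assumes "laurent v f" "laurent v g" shows "laurent v (f * g)"
proof -
  obtain N P M Q where e: "f * gen v ^ N = to_fract P" "g * gen v ^ M = to_fract Q"
    using assms by (auto simp: laurent_def)
  have "(f * g) * gen v ^ (N + M) = to_fract (P * Q)"
    unfolding to_fract_mult e[symmetric] by (simp add: algebra_simps power_add)
  then show ?thesis unfolding laurent_def by blast
qed

lemma laurent_uminus: "laurent v f \<Longrightarrow> laurent v (- f)"
  using laurent_mult[OF laurent_to_fract[of v "- 1"], of f] by simp

lemma laurent_diff: "laurent v f \<Longrightarrow> laurent v g \<Longrightarrow> laurent v (f - g)"
  using laurent_add[of v f "- g"] laurent_uminus[of v g] by simp

lemma laurent_power: "laurent v f \<Longrightarrow> laurent v (f ^ n)"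
  by (induction n) (simp_all add: laurent_1 laurent_mult)

lemma laurent_inverse_gen: "laurent v (1 / gen v ^ n)"
  unfolding laurent_def using gen_nonzero[of v] by (intro exI[of _ n] exI[of _ 1]) simp

lemma laurent_divide_gen:
  assumes "laurent v f" shows "laurent v (f / gen v ^ n)" "laurent v (f / gen v)"
  using laurent_mult[OF assms laurent_inverse_gen[of v n]] laurent_mult[OF assms laurent_inverse_gen[of v 1]] by simp_all

lemma laurent_psubst:
  assumes "\<And>u. laurent v (g u)" shows "laurent v (psubst g K)"
proof (induction K rule: mpoly_induct)
  case 0
  show ?case using laurent_to_fract[of v 0] by (simp add: psubst_def)
next
  case (add K m c)
  have "laurent v (\<Prod>u\<in>UNIV. g u ^ Poly_Mapping.lookup m u)"
    by (simp add: UNIV_coord laurent_mult laurent_power assms)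
  then show ?case
    using add unfolding psubst_eq_eval eval_mpoly_add[of coef, OF coef_hom(1,3)] eval_mpoly_single[of coef, OF coef_hom(1)]
    by (intro laurent_add laurent_mult laurent_coef)
qed

lemma laurent_0: "laurent v 0" using laurent_to_fract[of v 0] by simp

lemmas laurent_intros = laurent_0 laurent_add laurent_mult laurent_uminus laurent_diff laurent_power laurent_gen laurent_coef
  laurent_C laurent_T laurent_1 laurent_numeral laurent_divide_gen laurent_psubst laurent_to_fract

section \<open>Values of rational functions at points\<close>

abbreviation insertion :: "(coord \<Rightarrow> Ct) \<Rightarrow> hpoly \<Rightarrow> Ct" where
  "insertion p \<equiv> eval_mpoly (\<lambda>c. c) p"

lemma insertion_hom:
  "insertion p 0 = 0" "insertion p (P + Q) = insertion p P + insertion p Q"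
  "insertion p (P * Q) = insertion p P * insertion p Q"
  "insertion p (P - Q) = insertion p P - insertion p Q"
  "insertion p 1 = 1"
  "insertion p (Poly_Mapping.single 0 c) = c"
  "insertion p (Poly_Mapping.single (Poly_Mapping.single v 1) 1) = p v"
proof -
  note s = eval_mpoly_add[of "\<lambda>c. c", simplified] eval_mpoly_single[of "\<lambda>c. c", simplified] eval_mpoly_mult[of "\<lambda>c. c", simplified]
  show "insertion p 0 = 0" by (simp add: eval_mpoly_def)
  show "insertion p (P + Q) = insertion p P + insertion p Q" "insertion p (P * Q) = insertion p P * insertion p Q"
    by (rule s)+
  show "insertion p (P - Q) = insertion p P - insertion p Q"
    using s(1)[of p "P - Q" Q] by simp
  show c: "insertion p (Poly_Mapping.single 0 c) = c" for c by (simp add: s)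
  show "insertion p 1 = 1" using c[of 1] by simp
  show "insertion p (Poly_Mapping.single (Poly_Mapping.single v 1) 1) = p v"
    unfolding s by (simp add: lookup_single when_def if_distrib[of "\<lambda>n. _ ^ n"] cong: if_cong)
qed

fun point :: "'a \<Rightarrow> 'a \<Rightarrow> 'a \<Rightarrow> 'a \<Rightarrow> coord \<Rightarrow> 'a" where
  "point x y z w CX = x" | "point x y z w CY = y" | "point x y z w CZ = z" | "point x y z w CW = w"

text \<open>
  Evaluation at \<open>p\<close> is defined on the local ring at \<open>p\<close> only.  As a relation it can be
  computed term by term, with a side condition just for the divisions.
\<close>

definition has_value :: "(coord \<Rightarrow> Ct) \<Rightarrow> hrat \<Rightarrow> Ct \<Rightarrow> bool" where
  "has_value p f c \<longleftrightarrow> (\<exists>P Q. insertion p Q \<noteq> 0 \<and> f * to_fract Q = to_fract P \<and> c * insertion p Q = insertion p P)"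

lemma has_valueE:
  assumes "has_value p f c"
  obtains P Q where "insertion p Q \<noteq> 0" "f * to_fract Q = to_fract P" "c * insertion p Q = insertion p P"
  using assms unfolding has_value_def by blast

lemma has_value_unique:
  assumes "has_value p f c" "has_value p f c'" shows "c = c'"
proof -
  obtain P Q where 1: "insertion p Q \<noteq> 0" "f * to_fract Q = to_fract P" "c * insertion p Q = insertion p P"
    using assms(1) by (rule has_valueE)
  obtain P' Q' where 2: "insertion p Q' \<noteq> 0" "f * to_fract Q' = to_fract P'" "c' * insertion p Q' = insertion p P'"
    using assms(2) by (rule has_valueE)
  have "to_fract (P * Q') = to_fract (P' * Q)"
    unfolding to_fract_mult 1(2)[symmetric] 2(2)[symmetric] by (simp add: mult_ac)
  then have "P * Q' = P' * Q" unfolding to_fract_eq_iff .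
  then have "insertion p P * insertion p Q' = insertion p P' * insertion p Q"
    by (metis insertion_hom(3))
  then show ?thesis using 1(1) 2(1) unfolding 1(3)[symmetric] 2(3)[symmetric] by simp
qed

lemma has_value_to_fract: "has_value p (to_fract P) (insertion p P)"
  unfolding has_value_def by (intro exI[of _ P] exI[of _ 1]) (simp add: insertion_hom)

lemma has_value_add:
  assumes "has_value p f c" "has_value p f' c'" shows "has_value p (f + f') (c + c')"
proof -
  obtain P Q where 1: "insertion p Q \<noteq> 0" "f * to_fract Q = to_fract P" "c * insertion p Q = insertion p P"
    using assms(1) by (rule has_valueE)
  obtain P' Q' where 2: "insertion p Q' \<noteq> 0" "f' * to_fract Q' = to_fract P'" "c' * insertion p Q' = insertion p P'"
    using assms(2) by (rule has_valueE)
  show ?thesis unfolding has_value_def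
    using 1(1) 2(1)
    by (intro exI[of _ "P * Q' + P' * Q"] exI[of _ "Q * Q'"])
      (simp add: insertion_hom algebra_simps flip: 1(2,3) 2(2,3))
qed

lemma has_value_mult:
  assumes "has_value p f c" "has_value p f' c'" shows "has_value p (f * f') (c * c')"
proof -
  obtain P Q where 1: "insertion p Q \<noteq> 0" "f * to_fract Q = to_fract P" "c * insertion p Q = insertion p P"
    using assms(1) by (rule has_valueE)
  obtain P' Q' where 2: "insertion p Q' \<noteq> 0" "f' * to_fract Q' = to_fract P'" "c' * insertion p Q' = insertion p P'"
    using assms(2) by (rule has_valueE)
  show ?thesis unfolding has_value_def
    using 1(1) 2(1)
    by (intro exI[of _ "P * P'"] exI[of _ "Q * Q'"])
      (simp add: insertion_hom algebra_simps flip: 1(2,3) 2(2,3))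
qed

lemma has_value_inverse:
  assumes "has_value p f c" "c \<noteq> 0" shows "has_value p (1 / f) (1 / c)"
proof -
  obtain P Q where 1: "insertion p Q \<noteq> 0" "f * to_fract Q = to_fract P" "c * insertion p Q = insertion p P"
    using assms(1) by (rule has_valueE)
  have "insertion p P \<noteq> 0" using 1 assms(2) by (metis no_zero_divisors)
  moreover from this have "P \<noteq> 0" by (auto simp: insertion_hom)
  then have "f \<noteq> 0" using 1(2) by auto
  ultimately show ?thesis unfolding has_value_def
    using assms(2) by (intro exI[of _ Q] exI[of _ P]) (simp add: 1(2,3)[symmetric])
qed

lemma has_value_divide:
  assumes "has_value p f c" "has_value p f' c'" "c' \<noteq> 0" shows "has_value p (f / f') (c / c')"
  using has_value_mult[OF assms(1) has_value_inverse[OF assms(2,3)]] by simp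

lemma has_value_coef: "has_value p (coef c) c"
  unfolding coef_def using has_value_to_fract[of p "Poly_Mapping.single 0 c"] by (simp add: insertion_hom)

lemma has_value_C: "has_value p (C c) (to_fract [:c:])" and has_value_T: "has_value p T (to_fract [:0, 1:])"
  unfolding C_def T_def by (rule has_value_coef)+

lemma has_value_gen: "has_value p (gen v) (p v)"
  unfolding gen_def using has_value_to_fract insertion_hom(7) by metis

lemma has_value_1: "has_value p 1 1"
  using has_value_coef[of p 1] by (simp add: coef_hom)

lemma has_value_uminus: "has_value p f c \<Longrightarrow> has_value p (- f) (- c)"
  using has_value_mult[OF has_value_coef[of p "- 1"], of f c] coef_diff[of 0 1] by (simp add: coef_hom)

lemma has_value_diff:
  assumes "has_value p f c" "has_value p f' c'" shows "has_value p (f - f') (c - c')"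
  using has_value_add[OF assms(1) has_value_uminus[OF assms(2)]] by simp

lemma has_value_numeral: "has_value p (numeral n) (numeral n)"
proof -
  have "has_value p (of_nat n) (of_nat n)" for n
    by (induction n) (use has_value_coef[of p 0] in \<open>auto simp: coef_hom intro: has_value_add has_value_1\<close>)
  from this[of "numeral n"] show ?thesis by simp
qed

lemma has_value_power: "has_value p f c \<Longrightarrow> has_value p (f ^ n) (c ^ n)"
  by (induction n) (simp_all add: has_value_1 has_value_mult)

lemma has_value_psubst:
  assumes "\<And>v. has_value p (g v) (q v)"
  shows "has_value p (psubst g K) (insertion q K)"
proof (induction K rule: mpoly_induct)
  case 0
  show ?case using has_value_coef[of p 0] by (simp add: psubst_def insertion_hom coef_hom)
next
  case (add K m c)
  have "has_value p (\<Prod>u\<in>UNIV. g u ^ Poly_Mapping.lookup m u) (\<Prod>u\<in>UNIV. q u ^ Poly_Mapping.lookup m u)"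
    by (simp add: UNIV_coord has_value_mult has_value_power assms)
  then show ?case
    using add unfolding psubst_eq_eval eval_mpoly_add[of coef, OF coef_hom(1,3)] eval_mpoly_single[of coef, OF coef_hom(1)]
      insertion_hom eval_mpoly_single[of "\<lambda>c. c", OF refl]
    by (intro has_value_add has_value_mult has_value_coef)
qed

lemma has_value_0: "has_value p 0 0"
  using has_value_coef[of p 0] by (simp add: coef_hom)

lemma has_value_point:
  "has_value (point x y z w) X x" "has_value (point x y z w) Y y"
  "has_value (point x y z w) Z z" "has_value (point x y z w) W w"
  using has_value_gen[of "point x y z w" CX] has_value_gen[of "point x y z w" CY]
    has_value_gen[of "point x y z w" CZ] has_value_gen[of "point x y z w" CW] by simp_all

lemmas has_value_intros = has_value_0 has_value_point has_value_add has_value_mult has_value_uminus has_value_diff has_value_power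
  has_value_gen has_value_coef has_value_C has_value_T has_value_1 has_value_numeral has_value_divide has_value_to_fract

section \<open>The Hamiltonian in the five charts\<close>

lemma point_eq_case: "point x y z w = (\<lambda>v. case v of CX \<Rightarrow> x | CY \<Rightarrow> y | CZ \<Rightarrow> z | CW \<Rightarrow> w)"
  by (rule ext) (simp split: coord.split)

lemma partial_psubst:
  "partial u (psubst (point x' y' z' w') K) =
     psubst (point x' y' z' w') (mpderiv CX K) * partial u x' + psubst (point x' y' z' w') (mpderiv CY K) * partial u y'
     + psubst (point x' y' z' w') (mpderiv CZ K) * partial u z' + psubst (point x' y' z' w') (mpderiv CW K) * partial u w'"
  unfolding derivation_psubst[OF derivation_partial partial_coef] by (simp add: UNIV_coord add_ac)

text \<open>
  The left-hand side of the last hypothesis is the gradient of the new Hamiltonian, pulled back to the old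
  coordinates by the chain rule, after its partial derivatives have been replaced by the velocities of the
  new coordinates.  The function \<open>\<delta>\<close> accounts for the explicit \<open>t\<close>-dependence of the change.
\<close>

lemma pullback:
  assumes "becomes_polynomial_Hamiltonian H x' y' z' w'"
    and laurent: "laurent v x'" "laurent v y'" "laurent v z'" "laurent v w'" "laurent v \<delta>"
    and grad: "\<And>u. flow_diff H x' * partial u y' - flow_diff H y' * partial u x'
        + flow_diff H z' * partial u w' - flow_diff H w' * partial u z' = to_fract (mpderiv u H) + partial u \<delta>"
  shows "\<exists>K c. to_fract H + \<delta> = psubst (point x' y' z' w') K + coef c"
proof -
  obtain K where K: "flow_diff H x' = psubst (point x' y' z' w') (mpderiv CY K)"
      "flow_diff H y' = - psubst (point x' y' z' w') (mpderiv CX K)"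
      "flow_diff H z' = psubst (point x' y' z' w') (mpderiv CW K)"
      "flow_diff H w' = - psubst (point x' y' z' w') (mpderiv CZ K)"
    using assms(1) unfolding becomes_polynomial_Hamiltonian_def point_eq_case[symmetric] Let_def by blast
  have "laurent v (point x' y' z' w' u)" for u by (cases u) (simp_all add: laurent)
  then have "laurent v (to_fract H + \<delta> - psubst (point x' y' z' w') K)"
    by (intro laurent_intros laurent)
  moreover have "partial u (to_fract H + \<delta> - psubst (point x' y' z' w') K) = 0" for u
    using grad[of u] unfolding derivation_diff[OF derivation_partial] derivation_add[OF derivation_partial]
      partial_psubst partial_to_fract K by (simp add: algebra_simps)
  ultimately obtain c where "to_fract H + \<delta> - psubst (point x' y' z' w') K = coef c"
    using laurent_constant by blast
  then show ?thesis by (intro exI[of _ K] exI[of _ c]) (simp add: algebra_simps)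
qed

lemma pullback_value:
  assumes eq: "to_fract H + \<delta> = psubst (point x' y' z' w') K + coef c"
    and "has_value p x' a1" "has_value p y' a2" "has_value p z' a3" "has_value p w' a4" "has_value p \<delta> d"
  shows "insertion p H + d = insertion (point a1 a2 a3 a4) K + c"
proof (rule has_value_unique)
  show "has_value p (to_fract H + \<delta>) (insertion p H + d)"
    by (intro has_value_intros assms)
  have "has_value p (point x' y' z' w' v) (point a1 a2 a3 a4 v)" for v
    by (cases v) (simp_all add: assms)
  then show "has_value p (to_fract H + \<delta>) (insertion (point a1 a2 a3 a4) K + c)"
    unfolding eq by (intro has_value_intros has_value_psubst)
qed

lemmas partial_simps = derivation_simps[OF derivation_partial] partial_gen partial_C partial_T
lemmas partial_t_simps = derivation_simps[OF derivation_partial_t] partial_t_gen partial_t_C partial_t_T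

text \<open>
  In all five charts the gradient condition is checked by computing in the field: it holds because the
  change of coordinates is symplectic.  As \<open>t\<close> occurs only in the last chart, \<open>\<delta>\<close> is \<open>0\<close> in the first four.
\<close>

lemma hamiltonian_in_chart_0:
  assumes "becomes_polynomial_Hamiltonian H (1 / X) (- (((Y - 1) * X + C \<alpha>) * X)) Z W"
  obtains K c where "\<And>x y z w. x \<noteq> 0 \<Longrightarrow>
    insertion (point x y z w) H = insertion (point (1 / x) (- (((y - 1) * x + to_fract [:\<alpha>:]) * x)) z w) K + c"
proof -
  have "\<exists>K c. to_fract H + 0 = psubst (point (1 / X) (- (((Y - 1) * X + C \<alpha>) * X)) Z W) K + coef c"
  proof (rule pullback[OF assms, where v = CX])
    fix u
    show "flow_diff H (1 / X) * partial u (- (((Y - 1) * X + C \<alpha>) * X)) - flow_diff H (- (((Y - 1) * X + C \<alpha>) * X)) * partial u (1 / X)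
      + flow_diff H Z * partial u W - flow_diff H W * partial u Z = to_fract (mpderiv u H) + partial u 0"
      using gen_nonzero[of CX]
      by (cases u) (simp_all add: flow_diff_def partial_simps partial_t_simps field_simps power2_eq_square)
  qed (intro laurent_intros)+
  then obtain K c where K: "to_fract H + 0 = psubst (point (1 / X) (- (((Y - 1) * X + C \<alpha>) * X)) Z W) K + coef c" by blast
  have "insertion (point x y z w) H + 0
    = insertion (point (1 / x) (- (((y - 1) * x + to_fract [:\<alpha>:]) * x)) z w) K + c" if "x \<noteq> 0" for x y z w
    by (rule pullback_value[OF K]) (intro has_value_intros that power_not_zero)+
  then show ?thesis using that by simp
qed

lemma hamiltonian_in_chart_1:
  assumes "becomes_polynomial_Hamiltonian H (1 / X) (- ((Y * X + C \<alpha>) * X)) Z W"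
  obtains K c where "\<And>x y z w. x \<noteq> 0 \<Longrightarrow>
    insertion (point x y z w) H = insertion (point (1 / x) (- ((y * x + to_fract [:\<alpha>:]) * x)) z w) K + c"
proof -
  have "\<exists>K c. to_fract H + 0 = psubst (point (1 / X) (- ((Y * X + C \<alpha>) * X)) Z W) K + coef c"
  proof (rule pullback[OF assms, where v = CX])
    fix u
    show "flow_diff H (1 / X) * partial u (- ((Y * X + C \<alpha>) * X)) - flow_diff H (- ((Y * X + C \<alpha>) * X)) * partial u (1 / X)
      + flow_diff H Z * partial u W - flow_diff H W * partial u Z = to_fract (mpderiv u H) + partial u 0"
      using gen_nonzero[of CX]
      by (cases u) (simp_all add: flow_diff_def partial_simps partial_t_simps field_simps power2_eq_square)
  qed (intro laurent_intros)+
  then obtain K c where K: "to_fract H + 0 = psubst (point (1 / X) (- ((Y * X + C \<alpha>) * X)) Z W) K + coef c" by blast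
  have "insertion (point x y z w) H + 0
    = insertion (point (1 / x) (- ((y * x + to_fract [:\<alpha>:]) * x)) z w) K + c" if "x \<noteq> 0" for x y z w
    by (rule pullback_value[OF K]) (intro has_value_intros that power_not_zero)+
  then show ?thesis using that by simp
qed

lemma hamiltonian_in_chart_2:
  assumes "becomes_polynomial_Hamiltonian H (- (((X - Z) * Y - C \<alpha>) * Y)) (1 / Y) Z (W + Y)"
  obtains K c where "\<And>x y z w. y \<noteq> 0 \<Longrightarrow> insertion (point x y z w) H
    = insertion (point (- (((x - z) * y - to_fract [:\<alpha>:]) * y)) (1 / y) z (w + y)) K + c"
proof -
  have "\<exists>K c. to_fract H + 0 = psubst (point (- (((X - Z) * Y - C \<alpha>) * Y)) (1 / Y) Z (W + Y)) K + coef c"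
  proof (rule pullback[OF assms, where v = CY])
    fix u
    show "flow_diff H (- (((X - Z) * Y - C \<alpha>) * Y)) * partial u (1 / Y) - flow_diff H (1 / Y) * partial u (- (((X - Z) * Y - C \<alpha>) * Y))
      + flow_diff H Z * partial u (W + Y) - flow_diff H (W + Y) * partial u Z = to_fract (mpderiv u H) + partial u 0"
      using gen_nonzero[of CY]
      by (cases u) (simp_all add: flow_diff_def partial_simps partial_t_simps field_simps power2_eq_square)
  qed (intro laurent_intros)+
  then obtain K c where K: "to_fract H + 0 = psubst (point (- (((X - Z) * Y - C \<alpha>) * Y)) (1 / Y) Z (W + Y)) K + coef c" by blast
  have "insertion (point x y z w) H + 0
    = insertion (point (- (((x - z) * y - to_fract [:\<alpha>:]) * y)) (1 / y) z (w + y)) K + c" if "y \<noteq> 0" for x y z w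
    by (rule pullback_value[OF K]) (intro has_value_intros that power_not_zero)+
  then show ?thesis using that by simp
qed

lemma hamiltonian_in_chart_3:
  assumes "becomes_polynomial_Hamiltonian H X Y (1 / Z) (- ((W * Z + C \<alpha>) * Z))"
  obtains K c where "\<And>x y z w. z \<noteq> 0 \<Longrightarrow>
    insertion (point x y z w) H = insertion (point x y (1 / z) (- ((w * z + to_fract [:\<alpha>:]) * z))) K + c"
proof -
  have "\<exists>K c. to_fract H + 0 = psubst (point X Y (1 / Z) (- ((W * Z + C \<alpha>) * Z))) K + coef c"
  proof (rule pullback[OF assms, where v = CZ])
    fix u
    show "flow_diff H X * partial u Y - flow_diff H Y * partial u X
      + flow_diff H (1 / Z) * partial u (- ((W * Z + C \<alpha>) * Z)) - flow_diff H (- ((W * Z + C \<alpha>) * Z)) * partial u (1 / Z) = to_fract (mpderiv u H) + partial u 0"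
      using gen_nonzero[of CZ]
      by (cases u) (simp_all add: flow_diff_def partial_simps partial_t_simps field_simps power2_eq_square)
  qed (intro laurent_intros)+
  then obtain K c where K: "to_fract H + 0 = psubst (point X Y (1 / Z) (- ((W * Z + C \<alpha>) * Z))) K + coef c" by blast
  have "insertion (point x y z w) H + 0
    = insertion (point x y (1 / z) (- ((w * z + to_fract [:\<alpha>:]) * z))) K + c" if "z \<noteq> 0" for x y z w
    by (rule pullback_value[OF K]) (intro has_value_intros that power_not_zero)+
  then show ?thesis using that by simp
qed

text \<open>
  Here \<open>\<partial>w'/\<partial>t = 1 / z\<^sup>2\<close>.  A Hamiltonian producing this term in \<open>dw'/dt\<close> is \<open>1 / z\<close>, since
  \<open>dw'/dt = - \<partial>K/\<partial>z'\<close>.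
\<close>

lemma hamiltonian_in_chart_4:
  assumes "becomes_polynomial_Hamiltonian H X Y Z (W - 2 * C \<alpha> / Z + T / Z ^ 2)"
  obtains K c where "\<And>x y z w. z \<noteq> 0 \<Longrightarrow> insertion (point x y z w) H + 1 / z
    = insertion (point x y z (w - 2 * to_fract [:\<alpha>:] / z + to_fract [:0, 1:] / z ^ 2)) K + c"
proof -
  have "\<exists>K c. to_fract H + 1 / Z = psubst (point X Y Z (W - 2 * C \<alpha> / Z + T / Z ^ 2)) K + coef c"
  proof (rule pullback[OF assms, where v = CZ])
    fix u
    show "flow_diff H X * partial u Y - flow_diff H Y * partial u X
      + flow_diff H Z * partial u (W - 2 * C \<alpha> / Z + T / Z ^ 2) - flow_diff H (W - 2 * C \<alpha> / Z + T / Z ^ 2) * partial u Z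
      = to_fract (mpderiv u H) + partial u (1 / Z)"
      using gen_nonzero[of CZ]
      by (cases u) (simp_all add: flow_diff_def partial_simps partial_t_simps field_simps power2_eq_square)
  qed (intro laurent_intros)+
  then obtain K c where K: "to_fract H + 1 / Z = psubst (point X Y Z (W - 2 * C \<alpha> / Z + T / Z ^ 2)) K + coef c" by blast
  have "insertion (point x y z w) H + 1 / z
    = insertion (point x y z (w - 2 * to_fract [:\<alpha>:] / z + to_fract [:0, 1:] / z ^ 2)) K + c" if "z \<noteq> 0" for x y z w
    by (rule pullback_value[OF K]) (intro has_value_intros that power_not_zero)+
  then show ?thesis using that by simp
qed

section \<open>Regularity in one chart\<close>

text \<open>
  Multiplication by the variable removes the exceptional point \<open>0\<close>.
\<close>

lemma poly_eqI_nonzero: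
  fixes p q :: "'a::{idom,ring_char_0} poly"
  assumes "\<And>x. x \<noteq> 0 \<Longrightarrow> poly p x = poly q x"
  shows "p = q"
proof -
  have "poly ([:0, 1:] * (p - q)) x = 0" for x
    using assms[of x] by (cases "x = 0") simp_all
  then have "[:0, 1:] * (p - q) = 0" using poly_all_0_iff_0 by blast
  then show ?thesis by simp
qed

text \<open>
  The outer variable of \<open>P\<close> stands for the second argument.
\<close>

definition bipolynomial :: "('a::comm_ring_1 \<Rightarrow> 'a \<Rightarrow> 'a) \<Rightarrow> bool" where
  "bipolynomial f \<longleftrightarrow> (\<exists>P. \<forall>x y. f x y = poly (poly P [:y:]) x)"

lemma bipolynomial_const: "bipolynomial (\<lambda>x y. c)"
  unfolding bipolynomial_def by (rule exI[of _ "[:[:c:]:]"]) simp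

lemma bipolynomial_fst: "bipolynomial (\<lambda>x y. x)"
  unfolding bipolynomial_def by (rule exI[of _ "[:[:0, 1:]:]"]) simp

lemma bipolynomial_snd: "bipolynomial (\<lambda>x y. y)"
  unfolding bipolynomial_def by (rule exI[of _ "[:0, 1:]"]) simp

lemma bipolynomial_add: "bipolynomial f \<Longrightarrow> bipolynomial g \<Longrightarrow> bipolynomial (\<lambda>x y. f x y + g x y)"
  unfolding bipolynomial_def by (metis poly_add)

lemma bipolynomial_mult: "bipolynomial f \<Longrightarrow> bipolynomial g \<Longrightarrow> bipolynomial (\<lambda>x y. f x y * g x y)"
  unfolding bipolynomial_def by (metis poly_mult)

lemma bipolynomial_power: "bipolynomial f \<Longrightarrow> bipolynomial (\<lambda>x y. f x y ^ n)"
  by (induction n) (simp_all add: bipolynomial_const bipolynomial_mult)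

definition chart_regular :: "'a::field \<Rightarrow> ('a \<Rightarrow> 'a \<Rightarrow> 'a) \<Rightarrow> bool" where
  "chart_regular \<alpha> f \<longleftrightarrow>
     (\<exists>k. bipolynomial k \<and> (\<forall>x y. x \<noteq> 0 \<longrightarrow> f x y = k (1 / x) (- ((y * x + \<alpha>) * x))))"

lemma poly_altdef_le:
  fixes p :: "'a::comm_ring_1 poly"
  assumes "degree p \<le> M"
  shows "poly p x = (\<Sum>i\<le>M. coeff p i * x ^ i)"
proof -
  have "poly p x = poly (\<Sum>i\<le>M. monom (coeff p i) i) x"
    using poly_as_sum_of_monoms'[OF assms] by simp
  then show ?thesis by (simp add: poly_sum poly_monom)
qed

lemma bipolynomial_sum:
  fixes k :: "'a::comm_ring_1 \<Rightarrow> 'a \<Rightarrow> 'a"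
  assumes "bipolynomial k"
  obtains c M where "N \<le> M" "\<And>x y. k x y = (\<Sum>b\<le>M. \<Sum>a\<le>M. c a b * x ^ a * y ^ b)"
proof -
  obtain P where P: "\<And>x y. k x y = poly (poly P [:y:]) x"
    using assms by (auto simp: bipolynomial_def)
  define M where "M = N + degree P + (\<Sum>b\<le>degree P. degree (coeff P b))"
  have dM: "degree (coeff P b) \<le> M" for b
  proof (cases "b \<le> degree P")
    case True
    then have "degree (coeff P b) \<le> (\<Sum>b\<le>degree P. degree (coeff P b))"
      by (intro member_le_sum) auto
    then show ?thesis by (simp add: M_def)
  qed (simp add: coeff_eq_0)
  have "k x y = (\<Sum>b\<le>M. \<Sum>a\<le>M. coeff (coeff P b) a * x ^ a * y ^ b)" for x y
  proof -
    have "poly P [:y:] = (\<Sum>b\<le>M. coeff P b * [:y:] ^ b)"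
      by (rule poly_altdef_le) (simp add: M_def)
    then have "k x y = (\<Sum>b\<le>M. poly (coeff P b) x * y ^ b)"
      by (simp add: P poly_sum)
    then show ?thesis
      by (simp add: poly_altdef_le[OF dM] sum_distrib_right)
  qed
  then show ?thesis using that[of M "\<lambda>a b. coeff (coeff P b) a"] by (simp add: M_def)
qed

text \<open>
  Put \<open>y = u / x\<close>.  The monomial \<open>x ^ a y ^ b\<close> becomes \<open>x ^ (a - b) u ^ b\<close>, while the monomials in the new
  coordinates become \<open>x ^ (b - a) (- (u + \<alpha>)) ^ b\<close>.  Comparison of the coefficients of \<open>x ^ k\<close> leaves on the right
  only terms with \<open>b \<ge> k\<close>.
\<close>

lemma chart_regular_dvd:
  fixes h :: "nat \<Rightarrow> nat \<Rightarrow> 'a::{field,ring_char_0}"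
  assumes reg: "chart_regular \<alpha> (\<lambda>x y. \<Sum>a\<le>N. \<Sum>b\<le>N. h a b * x ^ a * y ^ b)"
    and supp: "\<And>a b. a > N \<Longrightarrow> h a b = 0"
  shows "[:\<alpha>, 1:] ^ k dvd (\<Sum>b\<le>N. monom (h (b + k) b) b)"
proof -
  obtain K where K: "bipolynomial K"
    and hK: "\<And>x y. x \<noteq> 0 \<Longrightarrow> (\<Sum>a\<le>N. \<Sum>b\<le>N. h a b * x ^ a * y ^ b) = K (1 / x) (- ((y * x + \<alpha>) * x))"
    using reg unfolding chart_regular_def by blast
  obtain M c where M: "N \<le> M" and c: "\<And>x y. K x y = (\<Sum>b\<le>M. \<Sum>a\<le>M. c a b * x ^ a * y ^ b)"
    by (rule bipolynomial_sum[OF K, of N]) (rule that, assumption, assumption)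
  \<comment> \<open>Both sides are multiplied by \<open>x ^ M\<close>, which makes all exponents natural numbers.\<close>
  define L where "L u = (\<Sum>a\<le>N. \<Sum>b\<le>N. monom (h a b * u ^ b) (M + a - b))" for u
  define R where "R u = (\<Sum>b\<le>M. \<Sum>a\<le>M. monom (c a b * (- (u + \<alpha>)) ^ b) (M + b - a))" for u
  have LR: "L u = R u" for u
  proof (rule poly_eqI_nonzero)
    fix x :: 'a assume x: "x \<noteq> 0"
    have "poly (L u) x = x ^ M * (\<Sum>a\<le>N. \<Sum>b\<le>N. h a b * x ^ a * (u / x) ^ b)"
      unfolding L_def poly_sum poly_monom sum_distrib_left
    proof (intro sum.cong refl)
      fix a b assume "a \<in> {..N}" "b \<in> {..N}"
      then have "x ^ (M + a - b) * x ^ b = x ^ M * x ^ a"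
        using M by (simp flip: power_add)
      then show "h a b * u ^ b * x ^ (M + a - b) = x ^ M * (h a b * x ^ a * (u / x) ^ b)"
        using x by (simp add: power_divide field_simps)
    qed
    also have "\<dots> = x ^ M * K (1 / x) (- ((u + \<alpha>) * x))"
      using hK[OF x, of "u / x"] x by simp
    also have "\<dots> = x ^ M * (\<Sum>b\<le>M. \<Sum>a\<le>M. c a b * (1 / x) ^ a * (- (u + \<alpha>) * x) ^ b)"
      unfolding c mult_minus_left ..
    also have "\<dots> = poly (R u) x"
      unfolding R_def poly_sum poly_monom sum_distrib_left
    proof (intro sum.cong refl)
      fix a b assume "a \<in> {..M}" "b \<in> {..M}"
      then have "x ^ (M + b - a) * x ^ a = x ^ M * x ^ b"
        by (simp flip: power_add)
      then show "x ^ M * (c a b * (1 / x) ^ a * (- (u + \<alpha>) * x) ^ b)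
          = c a b * (- (u + \<alpha>)) ^ b * x ^ (M + b - a)"
        using x unfolding power_mult_distrib by (simp add: power_divide field_simps)
    qed
    finally show "poly (L u) x = poly (R u) x" .
  qed
  have cL: "coeff (L u) (M + k) = (\<Sum>b\<le>N. h (b + k) b * u ^ b)" for u
  proof -
    have "coeff (L u) (M + k) = (\<Sum>b\<le>N. \<Sum>a\<le>N. if a = b + k then h a b * u ^ b else 0)"
      unfolding L_def coeff_sum coeff_monom
      by (subst sum.swap, intro sum.cong refl if_cong) (use M in auto)
    also have "\<dots> = (\<Sum>b\<le>N. h (b + k) b * u ^ b)"
      by (intro sum.cong refl) (auto simp: sum.delta supp)
    finally show ?thesis .
  qed
  define q where "q = (\<Sum>b\<le>M. if k \<le> b then smult (c (b - k) b * (- 1) ^ b) ([:\<alpha>, 1:] ^ (b - k)) else 0)"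
  have cR: "coeff (R u) (M + k) = poly ([:\<alpha>, 1:] ^ k * q) u" for u
  proof -
    have "coeff (R u) (M + k) = (\<Sum>b\<le>M. \<Sum>a\<le>M. if a = b - k \<and> k \<le> b then c a b * (- (u + \<alpha>)) ^ b else 0)"
      unfolding R_def coeff_sum coeff_monom
      by (intro sum.cong refl if_cong) auto
    also have "\<dots> = (\<Sum>b\<le>M. if k \<le> b then c (b - k) b * (- (u + \<alpha>)) ^ b else 0)"
      by (intro sum.cong refl) (auto simp: sum.delta)
    also have "\<dots> = poly ([:\<alpha>, 1:] ^ k * q) u"
      unfolding q_def poly_mult poly_sum sum_distrib_left
    proof (intro sum.cong refl)
      fix b
      have "(- (u + \<alpha>)) ^ b = (- 1) ^ b * ((u + \<alpha>) ^ k * (u + \<alpha>) ^ (b - k))" if "k \<le> b"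
        using that unfolding power_minus[of "u + \<alpha>"] by (simp flip: power_add)
      then show "(if k \<le> b then c (b - k) b * (- (u + \<alpha>)) ^ b else 0) = poly ([:\<alpha>, 1:] ^ k) u *
          poly (if k \<le> b then smult (c (b - k) b * (- 1) ^ b) ([:\<alpha>, 1:] ^ (b - k)) else 0) u"
        by (simp add: add.commute)
    qed
    finally show ?thesis .
  qed
  have "poly (\<Sum>b\<le>N. monom (h (b + k) b) b) u = poly ([:\<alpha>, 1:] ^ k * q) u" for u
    using cL[of u] cR[of u] LR[of u] by (simp add: poly_sum poly_monom)
  then have "(\<Sum>b\<le>N. monom (h (b + k) b) b) = [:\<alpha>, 1:] ^ k * q"
    by (intro poly_eqI_nonzero)
  then show ?thesis by simp
qed

text \<open>
  The part of weight \<open>k\<close> has as coefficients those of a polynomial in \<open>u\<close> of degree at most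
  \<open>(6 - k) / 2\<close>, which is less than \<open>k\<close> for \<open>k \<ge> 3\<close>.  For \<open>k = 2\<close> the divisibility means a double root
  at \<open>-\<alpha>\<close>, and for \<open>k = 1\<close> a simple one.
\<close>

lemma chart_regular_degree6:
  fixes h :: "nat \<Rightarrow> nat \<Rightarrow> 'a::{field,ring_char_0}"
  assumes reg: "chart_regular \<alpha> (\<lambda>x y. \<Sum>a\<le>6. \<Sum>b\<le>6. h a b * x ^ a * y ^ b)"
    and deg: "\<And>a b. a + b > 6 \<Longrightarrow> h a b = 0"
  shows "b + 3 \<le> a \<Longrightarrow> h a b = 0"
    and "h 3 1 = 2 * \<alpha> * h 4 2"
    and "h 2 0 = \<alpha>\<^sup>2 * h 4 2"
    and "h 1 0 = \<alpha> * h 2 1 - \<alpha>\<^sup>2 * h 3 2"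
proof -
  define p where "p k = (\<Sum>b\<le>6. monom (h (b + k) b) b)" for k
  have dvd: "[:\<alpha>, 1:] ^ k dvd p k" for k
    unfolding p_def by (rule chart_regular_dvd[OF reg]) (simp add: deg)
  have cp: "coeff (p k) b = h (b + k) b" for k b
    by (cases "b \<le> 6") (simp_all add: p_def coeff_sum coeff_monom deg)
  have p1: "p 1 = [:h 1 0, h 2 1, h 3 2:]"
    by (rule poly_eqI) (auto simp: cp coeff_pCons deg eval_nat_numeral split: nat.split)
  have p2: "p 2 = [:h 2 0, h 3 1, h 4 2:]"
    by (rule poly_eqI) (auto simp: cp coeff_pCons deg eval_nat_numeral split: nat.split)
  have "poly (p 1) (- \<alpha>) = 0"
    using dvd[of 1] by (auto simp: dvd_def)
  then show "h 1 0 = \<alpha> * h 2 1 - \<alpha>\<^sup>2 * h 3 2"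
    unfolding p1 by (simp add: algebra_simps power2_eq_square add_eq_0_iff)
  obtain q where q: "p 2 = [:\<alpha>, 1:] ^ 2 * q" using dvd[of 2] by (auto simp: dvd_def)
  have "poly (pderiv (p 2)) (- \<alpha>) = 0" "poly (p 2) (- \<alpha>) = 0"
    unfolding q power2_eq_square pderiv_mult by (simp_all add: pderiv_pCons)
  then have 1: "h 3 1 - 2 * \<alpha> * h 4 2 = 0" "h 2 0 - \<alpha> * (h 3 1 - \<alpha> * h 4 2) = 0"
    by (simp_all add: p2 pderiv_pCons algebra_simps)
  show 2: "h 3 1 = 2 * \<alpha> * h 4 2" using 1(1) by simp
  show "h 2 0 = \<alpha>\<^sup>2 * h 4 2" using 1(2) unfolding 2 by (simp add: algebra_simps power2_eq_square)
  show "h a b = 0" if "b + 3 \<le> a"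
  proof -
    define k where "k = a - b"
    have k: "k \<ge> 3" "a = b + k" using that by (auto simp: k_def)
    have "degree (p k) \<le> 2"
      by (rule degree_le) (use k in \<open>auto simp: cp deg\<close>)
    then have "p k = 0"
      using dvd_imp_degree_le[OF dvd[of k]] k by (auto simp: degree_linear_power)
    then show ?thesis using cp[of k b] k by simp
  qed
qed

lemma monom_dvd_mult_cancel:
  fixes p b :: "'a::idom poly"
  assumes "monom 1 n dvd p * b" "coeff b 0 \<noteq> 0"
  shows "monom 1 n dvd p"
  unfolding monom_1_dvd_iff'
proof (intro allI impI)
  fix k assume "k < n"
  then show "coeff p k = 0"
  proof (induction k rule: less_induct)
    case (less k)
    have "0 = coeff (p * b) k" using assms(1) less.prems by (simp add: monom_1_dvd_iff')
    also have "\<dots> = (\<Sum>i\<le>k. coeff p i * coeff b (k - i))" by (rule coeff_mult)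
    also have "\<dots> = (\<Sum>i\<le>k. if i = k then coeff p k * coeff b 0 else 0)"
      by (intro sum.cong refl) (use less in auto)
    finally show ?case using assms(2) by simp
  qed
qed

text \<open>
  Put \<open>b = 2 \<beta> z - t\<close>, so that \<open>w = s + b / z\<^sup>2\<close>.  The coefficient of \<open>s ^ i\<close> is the sum of the terms
  \<open>(n choose i) p\<^sub>n (b / z\<^sup>2) ^ (n - i)\<close>, and it must be a polynomial in \<open>z\<close>.  Multiplication by
  \<open>z ^ (2 (N - i))\<close> clears the denominators.
\<close>

lemma pole_chart_dvd:
  fixes p :: "nat \<Rightarrow> 'a::{field,ring_char_0} poly"
  assumes K: "bipolynomial K"
    and eq: "\<And>z s. z \<noteq> 0 \<Longrightarrow>
      (\<Sum>n\<le>N. poly (p n) z * (s + 2 * \<beta> / z - t / z\<^sup>2) ^ n) + \<epsilon> / z = K z s"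
    and i: "i \<le> N"
  shows "monom 1 (2 * (N - i)) dvd
    (\<Sum>n\<in>{i..N}. of_nat (n choose i) * p n * [:- t, 2 * \<beta>:] ^ (n - i) * monom 1 (2 * (N - n)))
      + (if i = 0 then monom \<epsilon> (2 * (N - i) - 1) else 0)"
proof (cases "N = 0")
  case True
  then show ?thesis using i by simp
next
  case False
  obtain P where P: "\<And>x y. K x y = poly (poly P [:y:]) x"
    using K by (auto simp: bipolynomial_def)
  let ?b = "[:- t, 2 * \<beta>:]"
  let ?S = "(\<Sum>n\<in>{i..N}. of_nat (n choose i) * p n * ?b ^ (n - i) * monom 1 (2 * (N - n)))
      + (if i = 0 then monom \<epsilon> (2 * (N - i) - 1) else 0)"
  have "?S = monom 1 (2 * (N - i)) * coeff P i"
  proof (rule poly_eqI_nonzero)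
    fix z :: 'a assume z: "z \<noteq> 0"
    define B where "B = 2 * \<beta> / z - t / z\<^sup>2"
    have B: "B * z\<^sup>2 = poly ?b z" using z by (simp add: B_def field_simps power2_eq_square)
    have coeff_linear: "coeff ([:B, 1:] ^ n) i = of_nat (n choose i) * B ^ (n - i)" for n i
      by (cases "i \<le> n") (simp_all add: coeff_linear_poly_power coeff_eq_0 degree_linear_power binomial_eq_0)
    define u where "u = (\<Sum>n\<le>N. smult (poly (p n) z) ([:B, 1:] ^ n)) + [:\<epsilon> / z:]"
    define v where "v = map_poly (\<lambda>c. poly c z) P"
    have "u = v"
    proof (rule poly_eqI_nonzero)
      fix s
      have "poly v s = poly (poly P [:s:]) z"
        unfolding v_def 
        by (subst poly_altdef_le[OF map_poly_degree_leq], subst (2) poly_altdef)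
          (simp add: poly_sum coeff_map_poly)
      moreover have "poly u s = (\<Sum>n\<le>N. poly (p n) z * (s + 2 * \<beta> / z - t / z\<^sup>2) ^ n) + \<epsilon> / z"
        by (simp add: u_def poly_sum B_def algebra_simps)
      ultimately show "poly u s = poly v s" using eq[OF z, of s] by (simp add: P)
    qed
    then have "coeff u i = poly (coeff P i) z" by (simp add: v_def coeff_map_poly)
    moreover have "coeff u i = (\<Sum>n\<le>N. poly (p n) z * (of_nat (n choose i) * B ^ (n - i)))
        + (if i = 0 then \<epsilon> / z else 0)"
      by (cases i) (simp_all add: u_def coeff_sum coeff_linear coeff_0_power)
    moreover have "(\<Sum>n\<le>N. poly (p n) z * (of_nat (n choose i) * B ^ (n - i)))
       = (\<Sum>n\<in>{i..N}. poly (p n) z * (of_nat (n choose i) * B ^ (n - i)))"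
      by (rule sum.mono_neutral_right) (auto simp: binomial_eq_0)
    ultimately have e: "poly (coeff P i) z = (\<Sum>n\<in>{i..N}. poly (p n) z * (of_nat (n choose i) * B ^ (n - i)))
        + (if i = 0 then \<epsilon> / z else 0)" by simp
    have 1: "z ^ (2 * (N - i)) * (poly (p n) z * (of_nat (n choose i) * B ^ (n - i)))
      = of_nat (n choose i) * poly (p n) z * poly ?b z ^ (n - i) * z ^ (2 * (N - n))"
      if "n \<in> {i..N}" for n
    proof -
      have "2 * (N - i) = 2 * (n - i) + 2 * (N - n)" using that by auto
      then have "z ^ (2 * (N - i)) = (z\<^sup>2) ^ (n - i) * z ^ (2 * (N - n))"
        by (simp add: power_add power_mult)
      then show ?thesis unfolding B[symmetric] by (simp add: power_mult_distrib mult_ac)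
    qed
    have 2: "z ^ (2 * (N - i)) * (if i = 0 then \<epsilon> / z else 0)
      = (if i = 0 then \<epsilon> * z ^ (2 * (N - i) - 1) else 0)"
    proof (cases "i = 0")
      case True
      obtain M where "N = Suc M" using False by (cases N) auto
      then show ?thesis using True z by simp
    qed simp
    have "poly (monom 1 (2 * (N - i)) * coeff P i) z = z ^ (2 * (N - i)) * poly (coeff P i) z"
      by (simp add: poly_monom)
    also have "\<dots> = (\<Sum>n\<in>{i..N}. of_nat (n choose i) * poly (p n) z * poly ?b z ^ (n - i) * z ^ (2 * (N - n)))
       + (if i = 0 then \<epsilon> * z ^ (2 * (N - i) - 1) else 0)"
      unfolding e distrib_left sum_distrib_left 2 by (simp only: sum.cong[OF refl 1])
    finally show "poly ?S z = poly (monom 1 (2 * (N - i)) * coeff P i) z"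
      by (simp add: poly_sum poly_monom)
  qed
  then show ?thesis by simp
qed

text \<open>
  Let \<open>N\<close> be the degree in \<open>w\<close> and \<open>p\<^sub>n\<close> the coefficient of \<open>w ^ n\<close>.  The coefficient of
  \<open>s ^ (N - 1)\<close> shows that \<open>z\<^sup>2\<close> divides \<open>p\<^sub>N\<close>.  If \<open>N \<ge> 3\<close>, the coefficients of \<open>s ^ (N - 2)\<close> and
  \<open>s ^ (N - 3)\<close> are two independent congruences modulo \<open>z\<^sup>2\<close> between \<open>p\<^sub>N b / z\<^sup>2\<close> and \<open>p\<^sub>N\<^sub>-\<^sub>1\<close>.  Hence
  \<open>z ^ 4\<close> divides \<open>p\<^sub>N\<close>, whose degree is at most \<open>6 - N \<le> 3\<close>.  For \<open>N = 2\<close> the coefficient of \<open>s ^ 0\<close>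
  is a congruence of this kind, with the additional term \<open>\<epsilon> z\<close>; its coefficients of \<open>1\<close> and \<open>z\<close> are the last two
  relations.
\<close>

lemma pole_chart_degree6:
  fixes h :: "nat \<Rightarrow> nat \<Rightarrow> 'a::{field,ring_char_0}"
  assumes K: "bipolynomial K"
    and eq: "\<And>z s. z \<noteq> 0 \<Longrightarrow>
      (\<Sum>m\<le>6. \<Sum>n\<le>6. h m n * z ^ m * (s + 2 * \<beta> / z - t / z\<^sup>2) ^ n) + \<epsilon> / z = K z s"
    and deg: "\<And>m n. m + n > 6 \<Longrightarrow> h m n = 0"
    and t: "t \<noteq> 0"
  shows "3 \<le> n \<Longrightarrow> h m n = 0"
    and "h 0 2 = 0" and "h 1 2 = 0"
    and "h 0 1 = t * h 2 2"
    and "t * h 1 1 = t\<^sup>2 * h 3 2 - 2 * \<beta> * t * h 2 2 + \<epsilon>"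
proof -
  let ?b = "[:- t, 2 * \<beta>:]"
  define p where "p n = (\<Sum>m\<le>6. monom (h m n) m)" for n
  have cp: "coeff (p n) m = h m n" for m n
    by (cases "m \<le> 6") (simp_all add: p_def coeff_sum coeff_monom deg)
  have dvd: "monom 1 (2 * (N - i)) dvd
    (\<Sum>n\<in>{i..N}. of_nat (n choose i) * p n * ?b ^ (n - i) * monom 1 (2 * (N - n)))
      + (if i = 0 then monom \<epsilon> (2 * (N - i) - 1) else 0)"
    if N: "i \<le> N" "N \<le> 6" and top: "\<And>n. n > N \<Longrightarrow> p n = 0" for i N
  proof (rule pole_chart_dvd[OF K _ N(1)])
    fix z s :: 'a assume z: "z \<noteq> 0"
    let ?w = "s + 2 * \<beta> / z - t / z\<^sup>2"
    have "(\<Sum>n\<le>N. poly (p n) z * ?w ^ n) = (\<Sum>n\<le>6. poly (p n) z * ?w ^ n)"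
      by (rule sum.mono_neutral_left) (use N top in auto)
    also have "\<dots> = (\<Sum>m\<le>6. \<Sum>n\<le>6. h m n * z ^ m * ?w ^ n)"
      by (subst sum.swap) (simp add: p_def poly_sum poly_monom sum_distrib_right)
    finally show "(\<Sum>n\<le>N. poly (p n) z * ?w ^ n) + \<epsilon> / z = K z s" using eq[OF z] by simp
  qed
  have b0: "coeff ?b 0 \<noteq> 0" using t by simp
  have top: "p N = 0" if N: "3 \<le> N" "N \<le> 6" and top: "\<And>n. n > N \<Longrightarrow> p n = 0" for N
  proof -
    define M where "M = N - 3"
    have M: "N = M + 3" using N(1) by (simp add: M_def)
    have ivl: "{M + 2..N} = {M + 2, N}" "{M + 1..N} = {M + 1, M + 2, N}" "{M..N} = {M, M + 1, M + 2, N}"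
      using M by auto
    define b where "b = ?b"
    define \<zeta> where "\<zeta> = (monom 1 2 :: 'a poly)"
    define \<Delta> where "\<Delta> = (if M = 0 then monom \<epsilon> 1 else 0)"
    have \<zeta>: "monom 1 4 = \<zeta> * \<zeta>" "monom 1 6 = \<zeta> * \<zeta> * \<zeta>" unfolding \<zeta>_def by (simp_all add: mult_monom)
    have \<Delta>: "(if M = 0 then monom \<epsilon> (2 * (N - M) - 1) else 0) = \<zeta> * \<zeta> * \<Delta>"
      by (simp add: M \<Delta>_def \<zeta>_def mult_monom)
    note cancel = monom_dvd_mult_cancel[of 2 _ b, folded \<zeta>_def, unfolded b_def, OF _ b0, folded b_def]
    define \<tau> where "\<tau> i n = of_nat (n choose i) * p n * b ^ (n - i) * monom 1 (2 * (N - n))" for i n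
    note dvd_top = dvd[OF _ N(2) top, folded b_def, folded \<tau>_def]
    have "\<zeta> dvd \<tau> (M + 2) N + \<tau> (M + 2) (M + 2)"
      using dvd_top[of "M + 2"] unfolding ivl by (simp add: M \<zeta>_def add.commute numeral_2_eq_2)
    then have "\<zeta> dvd of_nat (N choose (M + 2)) * p N * b + \<zeta> * p (M + 2)"
      by (simp add: \<tau>_def M \<zeta>_def mult_ac)
    then have "\<zeta> dvd (of_nat (N choose (M + 2)) * p N) * b"
      by (metis dvd_add_left_iff dvd_triv_left)
    then have "\<zeta> dvd of_nat (N choose (M + 2)) * p N" by (rule cancel)
    then have "\<zeta> dvd p N"
      unfolding \<zeta>_def monom_1_dvd_iff' M by (auto simp: of_nat_poly binomial_eq_0_iff)
    then obtain P where P: "p N = \<zeta> * P" by (auto simp: dvd_def)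
    define c where "c j = (of_nat ((M + 3) choose (M + j)) :: 'a poly)" for j
    define d where "d j = (of_nat ((M + 2) choose (M + j)) :: 'a poly)" for j
    have "\<zeta> * \<zeta> dvd \<tau> (M + 1) N + \<tau> (M + 1) (M + 2) + \<tau> (M + 1) (M + 1)"
      using dvd_top[of "M + 1"] unfolding ivl by (simp add: M \<zeta> add_ac)
    also have "\<tau> (M + 1) N + \<tau> (M + 1) (M + 2) + \<tau> (M + 1) (M + 1)
        = \<zeta> * ((c 1 * P * b + d 1 * p (M + 2)) * b) + \<zeta> * \<zeta> * p (M + 1)"
      unfolding \<tau>_def P using \<zeta>
      by (simp add: c_def d_def M \<zeta>_def[symmetric] power2_eq_square distrib_left distrib_right mult_ac)
    finally have "\<zeta> * \<zeta> dvd \<zeta> * ((c 1 * P * b + d 1 * p (M + 2)) * b)"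
      by (metis (no_types, lifting) dvd_add_left_iff dvd_triv_left)
    then have "\<zeta> dvd (c 1 * P * b + d 1 * p (M + 2)) * b"
      by (simp add: \<zeta>_def)
    then have d1: "\<zeta> dvd c 1 * P * b + d 1 * p (M + 2)" by (rule cancel)
    have "\<zeta> * \<zeta> dvd monom 1 (2 * (N - M))" by (simp add: M \<zeta>)
    also have "\<dots> dvd \<tau> M N + \<tau> M (M + 2) + \<tau> M (M + 1) + \<tau> M M + \<zeta> * \<zeta> * \<Delta>"
      using dvd_top[of M] unfolding ivl \<Delta> by (simp add: M add_ac)
    also have "\<tau> M N + \<tau> M (M + 2) + \<tau> M (M + 1) + \<tau> M M + \<zeta> * \<zeta> * \<Delta>
        = \<zeta> * ((c 0 * P * b + d 0 * p (M + 2)) * b * b) + \<zeta> * \<zeta> * (of_nat (M + 1) * p (M + 1) * b + p M * \<zeta> + \<Delta>)"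
      unfolding \<tau>_def P using \<zeta>
      by (simp add: c_def d_def M \<zeta>_def[symmetric] power2_eq_square power3_eq_cube distrib_left distrib_right mult_ac)
    finally have "\<zeta> * \<zeta> dvd \<zeta> * ((c 0 * P * b + d 0 * p (M + 2)) * b * b)"
      by (metis (no_types, lifting) dvd_add_left_iff dvd_triv_left)
    then have "\<zeta> dvd (c 0 * P * b + d 0 * p (M + 2)) * b * b"
      by (simp add: \<zeta>_def)
    then have d0: "\<zeta> dvd c 0 * P * b + d 0 * p (M + 2)" by (rule cancel[OF cancel])
    have "(M + 1) * ((M + 3) choose (M + 1)) = 3 * ((M + 3) choose M)"
      and "(M + 1) * ((M + 2) choose (M + 1)) = 2 * ((M + 2) choose M)"
      using Suc_times_binomial_add[of M 2] Suc_times_binomial_add[of M 1]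
      by (simp_all add: numeral_3_eq_3 numeral_2_eq_2 del: binomial_Suc_Suc mult_Suc mult_Suc_right)
    then have "(of_nat ((M + 1) * ((M + 3) choose (M + 1))) :: 'a poly) = of_nat (3 * ((M + 3) choose M))"
      and "(of_nat ((M + 1) * ((M + 2) choose (M + 1))) :: 'a poly) = of_nat (2 * ((M + 2) choose M))"
      by simp_all
    then have cd: "of_nat (M + 1) * c 1 = 3 * c 0" "of_nat (M + 1) * d 1 = 2 * d 0"
      unfolding c_def d_def of_nat_mult by simp_all
    \<comment> \<open>This combination eliminates \<open>p (M + 2)\<close>; the binomial identities leave the multiple \<open>c 0\<close> of \<open>P * b\<close>.\<close>
    have "\<zeta> dvd of_nat (M + 1) * (c 1 * P * b + d 1 * p (M + 2)) - 2 * (c 0 * P * b + d 0 * p (M + 2))"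
      by (intro dvd_diff dvd_mult d0 d1)
    also have "\<dots> = (of_nat (M + 1) * c 1) * P * b + (of_nat (M + 1) * d 1) * p (M + 2)
        - 2 * (c 0 * P * b + d 0 * p (M + 2))"
      by (simp only: distrib_left mult.assoc)
    also have "\<dots> = (c 0 * P) * b" unfolding cd by (simp add: algebra_simps)
    finally have "\<zeta> dvd c 0 * P" by (rule cancel)
    moreover have "(M + 3) choose M \<noteq> 0" by simp
    ultimately have "\<zeta> dvd P"
      unfolding \<zeta>_def monom_1_dvd_iff' c_def by (auto simp: of_nat_poly)
    then have "monom 1 4 dvd p N" unfolding P \<zeta> by (rule mult_dvd_mono[OF dvd_refl])
    moreover have "coeff (p N) m = 0" if "m \<ge> 4" for m
      using that N(1) by (simp add: cp deg)
    ultimately show ?thesis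
      by (intro poly_eqI) (metis monom_1_dvd_iff' coeff_0 not_less)
  qed
  have p6: "p n = 0" if "n > 6" for n by (rule poly_eqI) (use that in \<open>simp add: cp deg\<close>)
  have p5: "p n = 0" if "n > 5" for n using top[of 6] p6 that by (cases "n = 6") auto
  have p4: "p n = 0" if "n > 4" for n using top[of 5] p5 that by (cases "n = 5") auto
  have p3: "p n = 0" if "n > 3" for n using top[of 4] p4 that by (cases "n = 4") auto
  have p2: "p n = 0" if "n > 2" for n using top[of 3] p3 that by (cases "n = 3") auto
  show "3 \<le> n \<Longrightarrow> h m n = 0" using cp[of n m] p2[of n] by simp
  have ivl: "{1..2} = {1, 2::nat}" "{0..2} = {0, 1, 2::nat}" by auto
  define b where "b = ?b"
  note dvd' = dvd[folded b_def] and cancel = monom_dvd_mult_cancel[of 2 _ b, unfolded b_def, OF _ b0, folded b_def]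
  have "monom 1 2 dvd (2 * p 2) * b + monom 1 2 * p 1"
    using dvd'[of 1 2] p2 unfolding ivl by (simp add: mult_ac add_ac numeral_2_eq_2)
  then have "monom 1 2 dvd (2 * p 2) * b"
    by (metis dvd_add_left_iff dvd_triv_left)
  then have "monom 1 2 dvd 2 * p 2" by (rule cancel)
  then have "monom 1 2 dvd of_nat 2 * p 2" by simp
  then have 2: "monom 1 2 dvd p 2"
    unfolding monom_1_dvd_iff' of_nat_poly by simp
  show "h 0 2 = 0" and "h 1 2 = 0"
    using 2 unfolding monom_1_dvd_iff' cp by auto
  obtain P where P: "p 2 = monom 1 2 * P" using 2 by (auto simp: dvd_def)
  have P01: "coeff P 0 = h 2 2" "coeff P 1 = h 3 2"
    using arg_cong[OF P, of "\<lambda>q. coeff q 2"] arg_cong[OF P, of "\<lambda>q. coeff q 3"]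
    by (simp_all add: cp coeff_monom_mult)
  have \<zeta>: "monom 1 4 = monom 1 2 * (monom 1 2 :: 'a poly)" "monom \<epsilon> 3 = monom 1 2 * monom \<epsilon> 1"
    by (simp_all add: mult_monom)
  have "monom 1 2 * monom 1 2 dvd p 2 * b\<^sup>2 + p 1 * b * monom 1 2 + p 0 * monom 1 4 + monom \<epsilon> 3"
    using dvd'[of 0 2] p2 unfolding ivl \<zeta>(1)[symmetric] by (simp add: add_ac flip: numeral_2_eq_2)
  also have "\<dots> = monom 1 2 * (P * b * b + p 1 * b + monom 1 2 * p 0 + monom \<epsilon> 1)"
    unfolding P \<zeta> power2_eq_square by (simp only: distrib_left mult_ac)
  finally have "monom 1 2 dvd P * ?b * ?b + p 1 * ?b + monom 1 2 * p 0 + monom \<epsilon> 1"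
    unfolding b_def by simp
  then have cf: "coeff (P * ?b * ?b + p 1 * ?b + monom 1 2 * p 0 + monom \<epsilon> 1) i = 0" if "i < 2" for i
    using that unfolding monom_1_dvd_iff' by blast
  have "coeff (p 0 * monom 1 2) 0 = 0" "coeff (p 0 * monom 1 2) (Suc 0) = 0"
    by (simp_all add: mult.commute[of "p 0"] coeff_monom_mult)
  then have e0: "t * t * h 2 2 - t * h 0 1 = 0"
    and e1: "t * t * h 3 2 - 4 * \<beta> * t * h 2 2 - t * h 1 1 + 2 * \<beta> * h 0 1 + \<epsilon> = 0"
    using P01 cf[of 0] cf[of 1] by (simp_all add: cp coeff_monom_mult coeff_pCons algebra_simps)
  have "t * (t * h 2 2 - h 0 1) = 0" using e0 by (simp add: algebra_simps)
  then show h01: "h 0 1 = t * h 2 2" using t by simp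
  show "t * h 1 1 = t\<^sup>2 * h 3 2 - 2 * \<beta> * t * h 2 2 + \<epsilon>"
    using e1 unfolding h01 by (simp add: algebra_simps power2_eq_square)
qed

section \<open>Polynomials in four variables as tables of coefficients\<close>

definition bisum :: "nat \<Rightarrow> (nat \<Rightarrow> nat \<Rightarrow> 'a) \<Rightarrow> 'a::comm_ring_1 \<Rightarrow> 'a \<Rightarrow> 'a" where
  "bisum N f x y = (\<Sum>a\<le>N. \<Sum>b\<le>N. f a b * x ^ a * y ^ b)"

lemma bisum_linear:
  "bisum N (\<lambda>a b. f a b + g a b) x y = bisum N f x y + bisum N g x y"
  "bisum N (\<lambda>a b. f a b - g a b) x y = bisum N f x y - bisum N g x y"
  "bisum N (\<lambda>a b. c * f a b) x y = c * bisum N f x y"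
  by (simp_all add: bisum_def sum.distrib sum_subtractf sum_distrib_left algebra_simps)

lemma bisum_sum: "bisum N (\<lambda>a b. \<Sum>i\<in>I. f i a b) x y = (\<Sum>i\<in>I. bisum N (f i) x y)"
  by (induction I rule: infinite_finite_induct) (simp_all add: bisum_linear, simp_all add: bisum_def)

lemma bisum_bisum_swap:
  "bisum N (\<lambda>a b. bisum N (h a b) z w) x y = bisum N (\<lambda>m n. bisum N (\<lambda>a b. h a b m n) x y) z w"
proof -
  have "bisum N (\<lambda>a b. bisum N (h a b) z w) x y = bisum N (\<lambda>a b. \<Sum>m\<le>N. \<Sum>n\<le>N. (z ^ m * w ^ n) * h a b m n) x y"
    by (simp add: bisum_def[of N "h _ _"] mult_ac)
  also have "\<dots> = (\<Sum>m\<le>N. \<Sum>n\<le>N. (z ^ m * w ^ n) * bisum N (\<lambda>a b. h a b m n) x y)"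
    by (simp add: bisum_sum bisum_linear)
  finally show ?thesis by (simp add: bisum_def[of N _ z w] mult_ac)
qed

lemma bisum_eq_0D:
  fixes f :: "nat \<Rightarrow> nat \<Rightarrow> 'a::{idom,ring_char_0}"
  assumes "\<And>x y. bisum N f x y = 0" and "a \<le> N" "b \<le> N"
  shows "f a b = 0"
proof -
  have 1: "(\<Sum>b\<le>N. f a b * y ^ b) = 0" for y
  proof -
    have "poly (\<Sum>a\<le>N. monom (\<Sum>b\<le>N. f a b * y ^ b) a) x = 0" for x
      using assms(1)[of x y]
      by (simp add: bisum_def poly_sum poly_monom sum_distrib_left mult_ac)
    then have "(\<Sum>a\<le>N. monom (\<Sum>b\<le>N. f a b * y ^ b) a) = 0" using poly_all_0_iff_0 by blast
    from arg_cong[OF this, of "\<lambda>p. coeff p a"] show ?thesis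
      using assms(2) by (simp add: coeff_sum coeff_monom)
  qed
  have "poly (\<Sum>b\<le>N. monom (f a b) b) y = 0" for y
    using 1[of y] by (simp add: poly_sum poly_monom)
  then have "(\<Sum>b\<le>N. monom (f a b) b) = 0" using poly_all_0_iff_0 by blast
  from arg_cong[OF this, of "\<lambda>p. coeff p b"] show ?thesis
    using assms(3) by (simp add: coeff_sum coeff_monom)
qed

lemma bisum_eqD:
  fixes f :: "nat \<Rightarrow> nat \<Rightarrow> 'a::{idom,ring_char_0}"
  assumes "\<And>x y. bisum N f x y = bisum N g x y" and "a \<le> N" "b \<le> N"
  shows "f a b = g a b"
  using bisum_eq_0D[of N "\<lambda>a b. f a b - g a b" a b] assms by (simp add: bisum_linear)

text \<open>
  At fixed \<open>z\<close> and \<open>w\<close> the relations between the coefficients are linear, with constants that do not depend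
  on \<open>z\<close> and \<open>w\<close>.  Therefore they hold for each coefficient of \<open>z ^ m w ^ n\<close> separately.
\<close>

lemma chart_regular_degree6_coefficients:
  fixes h :: "nat \<Rightarrow> nat \<Rightarrow> nat \<Rightarrow> nat \<Rightarrow> 'a::{field,ring_char_0}"
  assumes reg: "\<And>z w. chart_regular \<alpha> (bisum 6 (\<lambda>a b. bisum 6 (h a b) z w))"
    and deg: "\<And>a b m n. a + b + m + n > 6 \<Longrightarrow> h a b m n = 0"
  shows "b + 3 \<le> a \<Longrightarrow> h a b m n = 0"
    and "h 3 1 m n = 2 * \<alpha> * h 4 2 m n"
    and "h 2 0 m n = \<alpha>\<^sup>2 * h 4 2 m n"
    and "h 1 0 m n = \<alpha> * h 2 1 m n - \<alpha>\<^sup>2 * h 3 2 m n"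
proof -
  have reg': "chart_regular \<alpha> (\<lambda>x y. \<Sum>a\<le>6. \<Sum>b\<le>6. bisum 6 (h a b) z w * x ^ a * y ^ b)" for z w
    using reg[of z w] by (simp only: bisum_def[of 6 "\<lambda>a b. bisum 6 (h a b) z w", abs_def])
  have deg': "bisum 6 (h a b) z w = 0" if "a + b > 6" for a b z w
    using that by (simp add: bisum_def deg)
  note c = chart_regular_degree6[OF reg' deg', simplified]
  have eqI: "f m n = g m n"
    if "\<And>z w. bisum 6 f z w = bisum 6 g z w" "\<not> (m \<le> 6 \<and> n \<le> 6) \<Longrightarrow> f m n = g m n" for f g :: "nat \<Rightarrow> nat \<Rightarrow> 'a" and m n
    using that bisum_eqD[of 6 f g m n] by blast
  show "h a b m n = 0" if "b + 3 \<le> a"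
    by (rule eqI[where g = "\<lambda>m n. 0 * h a b m n", simplified])
      (use that in \<open>auto simp: bisum_linear c(1) deg\<close>, simp add: bisum_def)
  show "h 3 1 m n = 2 * \<alpha> * h 4 2 m n"
    by (rule eqI) (auto simp: bisum_linear c(2) deg)
  show "h 2 0 m n = \<alpha>\<^sup>2 * h 4 2 m n"
    by (rule eqI) (auto simp: bisum_linear c(3) deg)
  show "h 1 0 m n = \<alpha> * h 2 1 m n - \<alpha>\<^sup>2 * h 3 2 m n"
    by (rule eqI) (use c(4) in \<open>auto simp: bisum_linear deg\<close>)
qed

lemma bisum_shift:
  fixes f :: "nat \<Rightarrow> nat \<Rightarrow> 'a::comm_ring_1"
  shows "bisum N f x (y + 1) = bisum N (\<lambda>a b. \<Sum>j\<le>N. of_nat (j choose b) * f a j) x y"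
proof -
  have "(\<Sum>j\<le>N. g j * (y + 1) ^ j) = (\<Sum>b\<le>N. (\<Sum>j\<le>N. of_nat (j choose b) * g j) * y ^ b)" for g :: "nat \<Rightarrow> 'a"
  proof -
    have "(y + 1) ^ j = (\<Sum>b\<le>N. of_nat (j choose b) * y ^ b)" if "j \<le> N" for j
    proof -
      have "(y + 1) ^ j = (\<Sum>b\<le>j. of_nat (j choose b) * y ^ b)" by (simp add: binomial_ring)
      also have "\<dots> = (\<Sum>b\<le>N. of_nat (j choose b) * y ^ b)"
        by (rule sum.mono_neutral_left) (use that in \<open>simp_all add: binomial_eq_0\<close>)
      finally show ?thesis .
    qed
    then have "(\<Sum>j\<le>N. g j * (y + 1) ^ j) = (\<Sum>j\<le>N. \<Sum>b\<le>N. of_nat (j choose b) * g j * y ^ b)"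
      by (intro sum.cong refl) (simp add: sum_distrib_left mult_ac)
    also have "\<dots> = (\<Sum>b\<le>N. (\<Sum>j\<le>N. of_nat (j choose b) * g j) * y ^ b)"
      by (subst sum.swap) (simp add: sum_distrib_right)
    finally show ?thesis .
  qed
  from this[of "\<lambda>j. f a j * x ^ a" for a] show ?thesis
    unfolding bisum_def by (simp add: sum_distrib_left mult_ac)
qed

text \<open>
  Let \<open>g\<^sub>a(y)\<close> be the coefficient of \<open>x ^ a\<close>.  If \<open>a\<close> is the degree in \<open>x\<close>, then \<open>g\<^sub>a\<close> is divisible by the powers of \<open>y\<close>
  and of \<open>y - 1\<close> with the exponent \<open>a / 2\<close> rounded up; for \<open>a \<ge> 3\<close> the degree of their product exceeds that of \<open>g\<^sub>a\<close>.  The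
  relations for \<open>a \<le> 2\<close> say \<open>g\<^sub>2(0) = g\<^sub>2(1) = 0\<close>, \<open>g\<^sub>1(0) = \<alpha>1 g\<^sub>2'(0)\<close> and \<open>g\<^sub>1(1) = \<alpha>0 g\<^sub>2'(1)\<close>.
\<close>

lemma two_shifted_charts:
  fixes h :: "nat \<Rightarrow> nat \<Rightarrow> nat \<Rightarrow> nat \<Rightarrow> 'a::{field,ring_char_0}"
  assumes r0: "\<And>z w. chart_regular \<alpha>0 (\<lambda>x y. bisum 6 (\<lambda>a b. bisum 6 (h a b) z w) x (y + 1))"
    and r1: "\<And>z w. chart_regular \<alpha>1 (bisum 6 (\<lambda>a b. bisum 6 (h a b) z w))"
    and deg: "\<And>a b m n. a + b + m + n > 6 \<Longrightarrow> h a b m n = 0"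
  shows "3 \<le> a \<Longrightarrow> h a b m n = 0"
    and "h 2 0 m n = 0"
    and "h 2 1 m n + h 2 2 m n + h 2 3 m n + h 2 4 m n = 0"
    and "h 1 0 m n = \<alpha>1 * h 2 1 m n"
    and "h 1 0 m n + h 1 1 m n + h 1 2 m n + h 1 3 m n + h 1 4 m n + h 1 5 m n =
      \<alpha>0 * (h 2 1 m n + 2 * h 2 2 m n + 3 * h 2 3 m n + 4 * h 2 4 m n)"
proof -
  \<comment> \<open>The coefficients after the translation \<open>y \<mapsto> y + 1\<close>.\<close>
  define g where "g a b m n = (\<Sum>j\<le>6. of_nat (j choose b) * h a j m n)" for a b m n
  have "bisum 6 (\<lambda>a b. bisum 6 (h a b) z w) x (y + 1) = bisum 6 (\<lambda>a b. bisum 6 (g a b) z w) x y" for x y z w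
    by (simp add: bisum_shift g_def[abs_def] bisum_sum bisum_linear)
  then have rg: "chart_regular \<alpha>0 (bisum 6 (\<lambda>a b. bisum 6 (g a b) z w))" for z w
    using r0[of z w] by (simp add: fun_eq_iff[symmetric])
  have dg: "g a b m n = 0" if "a + b + m + n > 6" for a b m n
    unfolding g_def
  proof (intro sum.neutral ballI)
    fix j show "of_nat (j choose b) * h a j m n = 0"
      using that by (cases "j < b") (simp_all add: deg binomial_eq_0)
  qed
  have G:
    "\<And>a b m n. b + 3 \<le> a \<Longrightarrow> g a b m n = 0"
    "g 3 1 m n = 2 * \<alpha>0 * g 4 2 m n"
    "g 2 0 m n = \<alpha>0\<^sup>2 * g 4 2 m n"
    "g 1 0 m n = \<alpha>0 * g 2 1 m n - \<alpha>0\<^sup>2 * g 3 2 m n" for m n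
    by (blast intro: chart_regular_degree6_coefficients[of \<alpha>0 g] rg dg)+
  have H:
    "\<And>a b m n. b + 3 \<le> a \<Longrightarrow> h a b m n = 0"
    "h 3 1 m n = 2 * \<alpha>1 * h 4 2 m n"
    "h 2 0 m n = \<alpha>1\<^sup>2 * h 4 2 m n"
    "h 1 0 m n = \<alpha>1 * h 2 1 m n - \<alpha>1\<^sup>2 * h 3 2 m n" for m n
    by (blast intro: chart_regular_degree6_coefficients[of \<alpha>1 h] r1 deg)+
  have six: "{..6} = {0, 1, 2, 3, 4, 5, 6::nat}" by auto
  have ch: "(4::nat) choose 2 = 6" "(3::nat) choose 2 = 3" by (simp_all add: eval_nat_numeral)
  have h42: "h 4 2 m n = 0" for m n
    using G(1)[of 0 4 m n] by (simp add: g_def six H(1) deg)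
  have h3: "h 3 0 m n = 0" "h 3 1 m n = 0" for m n using H(1)[of 0 3] H(2) h42 by simp_all
  have g42: "g 4 2 m n = 0" for m n by (simp add: g_def six H(1) deg h42)
  have "h 3 2 m n + h 3 3 m n = 0" "2 * h 3 2 m n + 3 * h 3 3 m n = 0" for m n
    using G(1)[of 0 3 m n] G(2)[of m n] by (simp_all add: g_def[of 3] six h3 h3[unfolded One_nat_def] deg g42)
  then have h323: "h 3 3 m n = 0" "h 3 2 m n = 0" for m n
  proof -
    have "h 3 3 m n = (2 * h 3 2 m n + 3 * h 3 3 m n) - 2 * (h 3 2 m n + h 3 3 m n)" by (simp add: algebra_simps)
    then show "h 3 3 m n = 0" using \<open>\<And>m n. h 3 2 m n + h 3 3 m n = 0\<close> \<open>\<And>m n. 2 * h 3 2 m n + 3 * h 3 3 m n = 0\<close> by simp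
    then show "h 3 2 m n = 0" using \<open>\<And>m n. h 3 2 m n + h 3 3 m n = 0\<close>[of m n] by simp
  qed
  show x3: "h a b m n = 0" if "3 \<le> a" for a b m n
  proof (cases "b + 3 \<le> a \<or> a + b > 6")
    case True then show ?thesis using H(1) deg by auto
  next
    case False
    then have "(a = 3 \<and> b \<in> {1, 2, 3}) \<or> (a = 4 \<and> b = 2)" using that by auto
    then show ?thesis using h3 h323 h42 by auto
  qed
  show h20: "h 2 0 m n = 0" using H(3) h42 by simp
  show "h 2 1 m n + h 2 2 m n + h 2 3 m n + h 2 4 m n = 0"
    using G(3)[of m n] by (simp add: g42 g_def[of 2] six h20 deg add_ac)
  show "h 1 0 m n = \<alpha>1 * h 2 1 m n" using H(4) h323 by simp
  have "g 3 2 m n = 0" by (simp add: g_def x3)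
  then show "h 1 0 m n + h 1 1 m n + h 1 2 m n + h 1 3 m n + h 1 4 m n + h 1 5 m n =
      \<alpha>0 * (h 2 1 m n + 2 * h 2 2 m n + 3 * h 2 3 m n + 4 * h 2 4 m n)"
    using G(4)[of m n] by (simp add: g_def six deg add_ac)
qed

section \<open>Elimination of the coefficients\<close>

text \<open>
  The relations of the two charts express all coefficients by five of them, which remain free.
\<close>

lemma two_charts_zw:
  fixes f :: "nat \<Rightarrow> nat \<Rightarrow> 'a::{field,ring_char_0}"
  assumes r3: "chart_regular \<alpha> (bisum 6 f)"
    and K: "bipolynomial K"
    and r4: "\<And>z s. z \<noteq> 0 \<Longrightarrow> bisum 6 f z (s + 2 * \<beta> / z - t / z\<^sup>2) + \<epsilon> / z = K z s"
    and deg: "\<And>m n. m + n > 6 \<Longrightarrow> f m n = 0"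
    and t: "t \<noteq> 0"
  shows "bisum 6 f z w =
      f 4 2 * z\<^sup>2 * (z * w + \<alpha>)\<^sup>2 + f 3 2 * (z ^ 3 * w\<^sup>2 - \<alpha>\<^sup>2 * z + t * z * w)
      + f 2 2 * (z\<^sup>2 * w\<^sup>2 - 2 * \<beta> * z * w + t * w) + f 2 1 * (z\<^sup>2 * w + \<alpha> * z)
      + f 0 0 + \<epsilon> / t * z * w"
proof -
  have r3': "chart_regular \<alpha> (\<lambda>z w. \<Sum>m\<le>6. \<Sum>n\<le>6. f m n * z ^ m * w ^ n)"
    using r3 by (simp add: bisum_def[abs_def])
  note R3 = chart_regular_degree6[OF r3' deg, simplified]
  note R4 = pole_chart_degree6[OF K r4[unfolded bisum_def] deg t, simplified]
  have six: "{..6} = {0, 1, 2, 3, 4, 5, 6::nat}" by auto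
  have f11: "f 1 1 = t * f 3 2 - 2 * \<beta> * f 2 2 + \<epsilon> / t"
    using R4(5) t by (simp add: field_simps power2_eq_square)
  have "bisum 6 f z w = f 0 0 + f 1 0 * z + f 2 0 * z ^ 2 + f 0 1 * w + f 1 1 * z * w + f 2 1 * z ^ 2 * w
      + f 3 1 * z ^ 3 * w + f 2 2 * z ^ 2 * w ^ 2 + f 3 2 * z ^ 3 * w ^ 2 + f 4 2 * z ^ 4 * w ^ 2"
    by (simp add: bisum_def six R3(1) R4(1,2,3) R4(2,3)[unfolded One_nat_def] deg)
  also have "\<dots> = f 4 2 * z\<^sup>2 * (z * w + \<alpha>)\<^sup>2 + f 3 2 * (z ^ 3 * w\<^sup>2 - \<alpha>\<^sup>2 * z + t * z * w)
      + f 2 2 * (z\<^sup>2 * w\<^sup>2 - 2 * \<beta> * z * w + t * w) + f 2 1 * (z\<^sup>2 * w + \<alpha> * z)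
      + f 0 0 + \<epsilon> / t * z * w"
    unfolding f11 R3(2)[folded One_nat_def] R3(3) R3(4)[folded One_nat_def] R4(4)[folded One_nat_def]
    by (simp add: algebra_simps power2_eq_square power3_eq_cube power4_eq_xxxx)
  finally show ?thesis .
qed

text \<open>
  The polynomials left by all charts except the one that mixes \<open>(x, y)\<close> with \<open>(z, w)\<close>.
\<close>

definition normal_form where
  "normal_form t \<alpha>3 \<alpha>4 c a b q e s k l x y z w =
     x\<^sup>2 * (y * (y - 1) * poly s y) + x * poly k y + poly l y
     + c * z\<^sup>2 * (z * w + \<alpha>3)\<^sup>2 + poly a y * (z ^ 3 * w\<^sup>2 - \<alpha>3\<^sup>2 * z + t * z * w)
     + poly b y * (z\<^sup>2 * w\<^sup>2 - 2 * \<alpha>4 * z * w + t * w)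
     + (x * (e * (y * (y - 1))) + poly q y) * (z\<^sup>2 * w + \<alpha>3 * z) + z * w / (t::'a::field)"

text \<open>
  In \<open>two_charts_zw\<close> the five free coefficients of \<open>z ^ m w ^ n\<close> are polynomials in \<open>x\<close> and \<open>y\<close> of degree at most
  \<open>6 - m - n\<close>, to which \<open>two_shifted_charts\<close> applies.  The coefficient of \<open>x\<^sup>2\<close> vanishes at
  \<open>y = 0\<close> and \<open>y = 1\<close>, so that it is a multiple of \<open>y (y - 1)\<close> and needs degree four; this excludes it from all but the
  lowest one.
\<close>

lemma normal_form_if_charts:
  fixes h :: "nat \<Rightarrow> nat \<Rightarrow> nat \<Rightarrow> nat \<Rightarrow> 'a::{field,ring_char_0}"
  assumes deg: "\<And>a b m n. a + b + m + n > 6 \<Longrightarrow> h a b m n = 0"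
    and t: "t \<noteq> 0"
    and r0: "\<And>z w. chart_regular \<alpha>0 (\<lambda>x y. bisum 6 (\<lambda>a b. bisum 6 (h a b) z w) x (y + 1))"
    and r1: "\<And>z w. chart_regular \<alpha>1 (bisum 6 (\<lambda>a b. bisum 6 (h a b) z w))"
    and r3: "\<And>x y. chart_regular \<alpha>3 (\<lambda>z w. bisum 6 (\<lambda>a b. bisum 6 (h a b) z w) x y)"
    and r4: "\<And>x y. \<exists>K. bipolynomial K \<and> (\<forall>z s. z \<noteq> 0 \<longrightarrow>
      bisum 6 (\<lambda>a b. bisum 6 (h a b) z (s + 2 * \<alpha>4 / z - t / z\<^sup>2)) x y + 1 / z = K z s)"
  obtains c a0 a1 b0 b1 b2 q0 q1 q2 q3 e s0 s1 s2 k0 k1 k2 k3 k4 k5 l0 l1 l2 l3 l4 l5 l6 where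
    "\<And>x y z w. bisum 6 (\<lambda>a b. bisum 6 (h a b) z w) x y =
       normal_form t \<alpha>3 \<alpha>4 c [:a0, a1:] [:b0, b1, b2:] [:q0, q1, q2, q3:] e [:s0, s1, s2:]
         [:k0, k1, k2, k3, k4, k5:] [:l0, l1, l2, l3, l4, l5, l6:] x y z w"
    "k0 = - (\<alpha>1 * s0)" "k0 + k1 + k2 + k3 + k4 + k5 = \<alpha>0 * (s0 + s1 + s2)"
proof -
  define S where "S x y m n = bisum 6 (\<lambda>a b. h a b m n) x y" for x y m n
  have S: "bisum 6 (\<lambda>a b. bisum 6 (h a b) z w) x y = bisum 6 (S x y) z w" for x y z w
    unfolding S_def by (rule bisum_bisum_swap)
  have zw: "bisum 6 (S x y) z w = S x y 4 2 * z\<^sup>2 * (z * w + \<alpha>3)\<^sup>2 + S x y 3 2 * (z ^ 3 * w\<^sup>2 - \<alpha>3\<^sup>2 * z + t * z * w)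
      + S x y 2 2 * (z\<^sup>2 * w\<^sup>2 - 2 * \<alpha>4 * z * w + t * w) + S x y 2 1 * (z\<^sup>2 * w + \<alpha>3 * z)
      + S x y 0 0 + 1 / t * z * w" for x y z w
  proof -
    obtain K where "bipolynomial K" "\<And>z s. z \<noteq> 0 \<Longrightarrow> bisum 6 (S x y) z (s + 2 * \<alpha>4 / z - t / z\<^sup>2) + 1 / z = K z s"
      using r4[of x y] unfolding S by blast
    moreover have "S x y m n = 0" if "m + n > 6" for m n
      using that by (simp add: S_def bisum_def deg)
    ultimately show ?thesis
      using r3[of x y] t unfolding S by (intro two_charts_zw) auto
  qed
  have xy: "3 \<le> a \<Longrightarrow> h a b m n = 0" "h 2 0 m n = 0"
    "h 2 1 m n + h 2 2 m n + h 2 3 m n + h 2 4 m n = 0"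
    "h 1 0 m n = \<alpha>1 * h 2 1 m n"
    "h 1 0 m n + h 1 1 m n + h 1 2 m n + h 1 3 m n + h 1 4 m n + h 1 5 m n =
      \<alpha>0 * (h 2 1 m n + 2 * h 2 2 m n + 3 * h 2 3 m n + 4 * h 2 4 m n)" for a b m n
    by (blast intro: two_shifted_charts[of \<alpha>0 h \<alpha>1] r0 r1 deg)+
  have six: "{..6} = {0, 1, 2, 3, 4, 5, 6::nat}" by auto
  have h10: "h 1 0 3 2 = 0" "h 2 1 2 2 = 0" "h 2 1 2 1 = 0" "h 1 0 2 2 = 0" "h 1 1 2 2 = 0" "h 1 0 2 1 = 0"
    "h 1 1 2 1 = - h 1 2 2 1"
    using xy(3,4,5)[where m = 3 and n = 2] xy(3,4,5)[where m = 2 and n = 2] xy(3,4,5)[where m = 2 and n = 1]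
    by (simp_all add: deg eq_neg_iff_add_eq_0)
  note z = h10 h10[unfolded One_nat_def] xy(1,2) deg
  have S42: "S x y 4 2 = h 0 0 4 2" for x y by (simp add: S_def bisum_def six z)
  have S32: "S x y 3 2 = poly [:h 0 0 3 2, h 0 1 3 2:] y" for x y
    by (simp add: S_def bisum_def six z)
  have S22: "S x y 2 2 = poly [:h 0 0 2 2, h 0 1 2 2, h 0 2 2 2:] y" for x y
    by (simp add: S_def bisum_def six z algebra_simps power2_eq_square)
  have S21: "S x y 2 1 = x * (h 1 2 2 1 * (y * (y - 1))) + poly [:h 0 0 2 1, h 0 1 2 1, h 0 2 2 1, h 0 3 2 1:] y" for x y
    by (simp add: S_def bisum_def six z, simp add: algebra_simps power_numeral_reduce)
  define s0 where "s0 = - h 2 1 0 0"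
  define s1 where "s1 = h 2 3 0 0 + h 2 4 0 0"
  define s2 where "s2 = h 2 4 0 0"
  have s: "h 2 1 0 0 = - s0" "h 2 2 0 0 = s0 - s1" "h 2 3 0 0 = s1 - s2" "h 2 4 0 0 = s2"
    using xy(3)[where m = 0 and n = 0] by (simp_all add: s0_def s1_def s2_def algebra_simps eq_neg_iff_add_eq_0)
  let ?k = "[:h 1 0 0 0, h 1 1 0 0, h 1 2 0 0, h 1 3 0 0, h 1 4 0 0, h 1 5 0 0:]"
  let ?l = "[:h 0 0 0 0, h 0 1 0 0, h 0 2 0 0, h 0 3 0 0, h 0 4 0 0, h 0 5 0 0, h 0 6 0 0:]"
  have S00: "S x y 0 0 = x\<^sup>2 * (y * (y - 1) * poly [:s0, s1, s2:] y) + x * poly ?k y + poly ?l y" for x y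
    by (simp add: S_def bisum_def six z s s[unfolded One_nat_def], simp add: algebra_simps power_numeral_reduce)
  show ?thesis
  proof (rule that)
    show "bisum 6 (\<lambda>a b. bisum 6 (h a b) z w) x y =
       normal_form t \<alpha>3 \<alpha>4 (h 0 0 4 2) [:h 0 0 3 2, h 0 1 3 2:] [:h 0 0 2 2, h 0 1 2 2, h 0 2 2 2:]
         [:h 0 0 2 1, h 0 1 2 1, h 0 2 2 1, h 0 3 2 1:] (h 1 2 2 1) [:s0, s1, s2:] ?k ?l x y z w" for x y z w
      unfolding S zw S42 S32 S22 S21 S00 normal_form_def by (simp only: add_ac) simp
    show "h 1 0 0 0 = - (\<alpha>1 * s0)" using xy(4)[where m = 0 and n = 0] unfolding s by simp
    show "h 1 0 0 0 + h 1 1 0 0 + h 1 2 0 0 + h 1 3 0 0 + h 1 4 0 0 + h 1 5 0 0 = \<alpha>0 * (s0 + s1 + s2)"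
      using xy(5)[where m = 0 and n = 0] unfolding s by (simp add: algebra_simps)
  qed
qed

lemma poly_eq_0I:
  fixes p :: "'a::{idom,ring_char_0} poly"
  shows "(\<And>x. poly p x = 0) \<Longrightarrow> p = 0"
  using poly_all_0_iff_0 by blast

text \<open>
  Put \<open>u = x - z\<close> and \<open>v = w + y\<close>.  At fixed \<open>z\<close> and \<open>v\<close> the remaining chart is of the common shape in the
  variables \<open>(y, u)\<close>.  The relations are polynomial identities in \<open>z\<close> and \<open>v\<close>.  Taken by decreasing powers
  of \<open>u\<close> and then of \<open>y\<close>, they form a triangular system for the constants.
\<close>

lemma normal_form_unique:
  fixes t :: "'a::{field,ring_char_0}"
  assumes params: "\<alpha>0 + \<alpha>1 + 2 * \<alpha>2 + 2 * \<alpha>3 + 2 * \<alpha>4 = 1"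
    and t: "t \<noteq> 0"
    and N: "N = normal_form t \<alpha>3 \<alpha>4 c [:a0, a1:] [:b0, b1, b2:] [:q0, q1, q2, q3:] e [:s0, s1, s2:]
         [:k0, k1, k2, k3, k4, k5:] [:l0, l1, l2, l3, l4, l5, l6:]"
    and k0: "k0 = - (\<alpha>1 * s0)" and k: "k0 + k1 + k2 + k3 + k4 + k5 = \<alpha>0 * (s0 + s1 + s2)"
    and r2: "\<And>z v. chart_regular (- \<alpha>2) (\<lambda>y u. N (u + z) y z (v - y))"
  shows "N x y z w = (x\<^sup>2 * y\<^sup>2 - x\<^sup>2 * y + (\<alpha>0 + \<alpha>1) * x * y - \<alpha>1 * x
     + z\<^sup>2 * w\<^sup>2 - z\<^sup>2 * w + (1 - 2 * \<alpha>4) * z * w - \<alpha>3 * z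
     + 2 * y * z\<^sup>2 * w + 2 * \<alpha>3 * y * z) / t + y + w + l0"
proof -
  define M1 where "M1 z v = [:z\<^sup>2 * (z * v + \<alpha>3)\<^sup>2, - 2 * z ^ 3 * (z * v + \<alpha>3), z ^ 4:]" for z v
  define M2 where "M2 z v = [:z ^ 3 * v\<^sup>2 - \<alpha>3\<^sup>2 * z + t * z * v, - 2 * z ^ 3 * v - t * z, z ^ 3:]" for z v
  define M3 where "M3 z v = [:z\<^sup>2 * v\<^sup>2 - 2 * \<alpha>4 * z * v + t * v, - 2 * z\<^sup>2 * v + 2 * \<alpha>4 * z - t, z\<^sup>2:]" for z v
  define M4 where "M4 z v = [:z\<^sup>2 * v + \<alpha>3 * z, - z\<^sup>2:]" for z v
  \<comment> \<open>The coefficients of \<open>x\<^sup>2\<close>, \<open>x\<close> and \<open>1\<close> after the substitution \<open>w = v - y\<close>, as polynomials in \<open>y\<close>.\<close>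
  define G2 where "G2 = [:0, - s0, s0 - s1, s1 - s2, s2:]"
  define G1 where "G1 z v = [:k0, k1, k2, k3, k4, k5:] + smult e [:0, - 1, 1:] * M4 z v" for z v
  define G0 where "G0 z v = [:l0, l1, l2, l3, l4, l5, l6:] + smult c (M1 z v) + [:a0, a1:] * M2 z v
    + [:b0, b1, b2:] * M3 z v + [:q0, q1, q2, q3:] * M4 z v + [:z * v / t, - z / t:]" for z v
  have NG: "N x y z (v - y) = poly G2 y * x\<^sup>2 + poly (G1 z v) y * x + poly (G0 z v) y" for x y z v
  proof -
    have m1: "z\<^sup>2 * (z * (v - y) + \<alpha>3)\<^sup>2 = poly (M1 z v) y"
      by (simp add: M1_def algebra_simps eval_nat_numeral)
    have m2: "z ^ 3 * (v - y)\<^sup>2 - \<alpha>3\<^sup>2 * z + t * z * (v - y) = poly (M2 z v) y"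
      by (simp add: M2_def algebra_simps eval_nat_numeral)
    have m3: "z\<^sup>2 * (v - y)\<^sup>2 - 2 * \<alpha>4 * z * (v - y) + t * (v - y) = poly (M3 z v) y"
      by (simp add: M3_def algebra_simps eval_nat_numeral)
    have m4: "z\<^sup>2 * (v - y) + \<alpha>3 * z = poly (M4 z v) y"
      by (simp add: M4_def algebra_simps eval_nat_numeral)
    have g2: "y * (y - 1) * poly [:s0, s1, s2:] y = poly G2 y"
      by (simp add: G2_def algebra_simps)
    have 5: "z * (v - y) / t = poly [:z * v / t, - z / t:] y" using t by (simp add: field_simps)
    have 6: "e * (y * (y - 1)) = poly (smult e [:0, - 1, 1:]) y" by (simp add: algebra_simps)
    show ?thesis
      unfolding N normal_form_def g2 mult.assoc[of c] m1 m2 m3 m4 5 6 G1_def G0_def poly_add poly_mult poly_smult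
      by (simp only: distrib_left distrib_right mult_ac add_ac)
  qed
  \<comment> \<open>The coefficient of \<open>u ^ b\<close> after the substitution \<open>x = u + z\<close>.\<close>
  define L where "L z v b = (if b = 0 then smult (z\<^sup>2) G2 + smult z (G1 z v) + G0 z v
    else if b = 1 then smult (2 * z) G2 + G1 z v else if b = 2 then G2 else 0)" for z v and b :: nat
  have degL: "coeff (L z v b) a = 0" if "a + b > 6" for z v a b
  proof -
    have "b = 0 \<and> a > 6 \<or> b = 1 \<and> a > 5 \<or> b = 2 \<and> a > 4 \<or> b > 2" using that by linarith
    then show ?thesis
      by (elim disjE conjE)
        (simp_all add: L_def G0_def G1_def G2_def M1_def M2_def M3_def M4_def coeff_pCons eval_nat_numeral split: nat.split)
  qed
  have six: "{..6} = {0, 1, 2, 3, 4, 5, 6::nat}" by auto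
  have "N (u + z) y z (v - y) = (\<Sum>a\<le>6. \<Sum>b\<le>6. coeff (L z v b) a * y ^ a * u ^ b)" for y u z v
  proof -
    have "(\<Sum>a\<le>6. \<Sum>b\<le>6. coeff (L z v b) a * y ^ a * u ^ b) = (\<Sum>b\<le>6. poly (L z v b) y * u ^ b)"
    proof (subst sum.swap, rule sum.cong[OF refl])
      fix b :: nat
      have "degree (L z v b) \<le> 6" by (rule degree_le) (simp add: degL)
      then show "(\<Sum>a\<le>6. coeff (L z v b) a * y ^ a * u ^ b) = poly (L z v b) y * u ^ b"
        by (simp add: poly_altdef_le sum_distrib_right)
    qed
    also have "\<dots> = N (u + z) y z (v - y)"
      unfolding NG by (simp add: six L_def algebra_simps power2_eq_square)
    finally show ?thesis by simp
  qed
  then have "chart_regular (- \<alpha>2) (\<lambda>y u. \<Sum>a\<le>6. \<Sum>b\<le>6. coeff (L z v b) a * y ^ a * u ^ b)" for z v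
    using r2[of z v] by simp
  note R = chart_regular_degree6[OF this degL]
  note defs = L_def G0_def G1_def G2_def M1_def M2_def M3_def M4_def
  \<comment> \<open>The coefficient of \<open>u\<close>.\<close>
  have "k5 = 0" using R(1)[of 1 5 0 0] by (simp add: defs eval_nat_numeral)
  have "poly [:k4, 2 * s2:] z = 0" for z
    using R(1)[of 1 4 z 0] by (simp add: defs eval_nat_numeral algebra_simps)
  then have "[:k4, 2 * s2:] = 0" by (rule poly_eq_0I)
  then have "k4 = 0" "s2 = 0" by simp_all
  have "poly [:k3, 2 * s1, - e:] z = 0" for z
    using R(2)[of z 0] \<open>s2 = 0\<close> by (simp add: defs eval_nat_numeral algebra_simps)
  then have "[:k3, 2 * s1, - e:] = 0" by (rule poly_eq_0I)
  then have "k3 = 0" "s1 = 0" "e = 0" by simp_all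
  note zero1 = \<open>k5 = 0\<close> \<open>k4 = 0\<close> \<open>k3 = 0\<close> \<open>s2 = 0\<close> \<open>s1 = 0\<close> \<open>e = 0\<close>
  \<comment> \<open>The coefficient of \<open>u ^ 0\<close>, by decreasing powers of \<open>y\<close>.\<close>
  have l6: "l6 = 0" using R(1)[of 0 6 0 0] by (simp add: defs zero1 eval_nat_numeral)
  have l5: "l5 = 0" using R(1)[of 0 5 0 0] by (simp add: defs zero1 eval_nat_numeral)
  have "poly [:l4, 0, b2 - q3:] z = 0" for z
    using R(1)[of 0 4 z 0] by (simp add: defs zero1 eval_nat_numeral algebra_simps)
  then have "[:l4, 0, b2 - q3:] = 0" by (rule poly_eq_0I)
  then have l4: "l4 = 0" and q3: "q3 = b2" by simp_all
  have "poly [:l3 - t * b2, 2 * \<alpha>4 * b2 + \<alpha>3 * b2, b1 - q2 - b2 * v, a1:] z = 0" for z v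
    using R(1)[of 0 3 z v] by (simp add: defs zero1 q3 eval_nat_numeral algebra_simps)
  then have "[:l3 - t * b2, 2 * \<alpha>4 * b2 + \<alpha>3 * b2, b1 - q2 - b2 * v, a1:] = 0" for v by (rule poly_eq_0I)
  then have "l3 = t * b2" "a1 = 0" and 3: "b1 - q2 - b2 * v = 0" for v by simp_all
  have "b1 - q2 = 0" "b2 = 0" using 3[of 0] 3[of 1] by simp_all
  then have zero2: "b2 = 0" "a1 = 0" "l3 = 0" "q2 = b1" "l4 = 0" "l5 = 0" "l6 = 0" "q3 = 0"
    using \<open>l3 = t * b2\<close> \<open>a1 = 0\<close> l4 l5 l6 q3 by simp_all
  have "poly [:l2 - t * b1, k2 + 2 * \<alpha>4 * b1 + \<alpha>3 * b1, s0 + b0 - q1 - b1 * v, a0, c:] z = 0" for z v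
    using R(3)[of z v] by (simp add: defs zero1 zero2 eval_nat_numeral algebra_simps)
  then have "[:l2 - t * b1, k2 + 2 * \<alpha>4 * b1 + \<alpha>3 * b1, s0 + b0 - q1 - b1 * v, a0, c:] = 0" for v
    by (rule poly_eq_0I)
  then have "l2 = t * b1" "k2 + 2 * \<alpha>4 * b1 + \<alpha>3 * b1 = 0" "a0 = 0" "c = 0"
    and 2: "s0 + b0 - q1 - b1 * v = 0" for v by simp_all
  have "b1 = 0" "q1 = s0 + b0" using 2[of 0] 2[of 1] by simp_all
  then have zero3: "b1 = 0" "l2 = 0" "k2 = 0" "a0 = 0" "c = 0" "q1 = s0 + b0" "q2 = 0"
    using \<open>l2 = t * b1\<close> \<open>k2 + 2 * \<alpha>4 * b1 + \<alpha>3 * b1 = 0\<close> \<open>a0 = 0\<close> \<open>c = 0\<close> \<open>q2 = b1\<close> by simp_all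
  have "poly [:l1 - t * b0, k1 + 2 * \<alpha>4 * b0 + \<alpha>3 * (s0 + b0) + 2 * \<alpha>2 * s0 - 1 / t,
      - s0 - q0 + (s0 - b0) * v:] z = 0" for z v
    using R(4)[of z v] by (simp add: defs zero1 zero2 zero3 eval_nat_numeral algebra_simps)
  then have "[:l1 - t * b0, k1 + 2 * \<alpha>4 * b0 + \<alpha>3 * (s0 + b0) + 2 * \<alpha>2 * s0 - 1 / t,
      - s0 - q0 + (s0 - b0) * v:] = 0" for v
    by (rule poly_eq_0I)
  then have l1: "l1 = t * b0" and s0: "k1 + 2 * \<alpha>4 * b0 + \<alpha>3 * (s0 + b0) + 2 * \<alpha>2 * s0 - 1 / t = 0"
    and 1: "- s0 - q0 + (s0 - b0) * v = 0" for v by simp_all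
  have q0: "q0 = - s0" using 1[of 0] by (simp add: algebra_simps)
  have b0: "b0 = s0" using 1[of 1] q0 by simp
  \<comment> \<open>The charts \<open>0\<close> and \<open>1\<close> determine the values of the coefficient of \<open>x\<close> at \<open>y = 1\<close> and \<open>y = 0\<close>.\<close>
  have k1: "k1 = (\<alpha>0 + \<alpha>1) * s0" using k by (simp add: k0 zero1 zero2 zero3 algebra_simps)
  have "(\<alpha>0 + \<alpha>1 + 2 * \<alpha>2 + 2 * \<alpha>3 + 2 * \<alpha>4) * s0 = 1 / t"
    using s0 unfolding b0 k1 by (simp add: algebra_simps)
  then have s0: "s0 = 1 / t" by (simp add: params)
  have "N x y z w = x\<^sup>2 * (y * (y - 1)) * s0 + x * (k0 + k1 * y) + l0 + l1 * y
      + b0 * (z\<^sup>2 * w\<^sup>2 - 2 * \<alpha>4 * z * w + t * w) + (q0 + q1 * y) * (z\<^sup>2 * w + \<alpha>3 * z) + z * w / t"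
    unfolding N normal_form_def by (simp add: zero1 zero2 zero3 algebra_simps)
  also have "\<dots> = (x\<^sup>2 * y\<^sup>2 - x\<^sup>2 * y + (\<alpha>0 + \<alpha>1) * x * y - \<alpha>1 * x
     + z\<^sup>2 * w\<^sup>2 - z\<^sup>2 * w + (1 - 2 * \<alpha>4) * z * w - \<alpha>3 * z
     + 2 * y * z\<^sup>2 * w + 2 * \<alpha>3 * y * z) / t + y + w + l0"
    using t by (simp add: k0 k1 b0 l1 q0 zero3 s0 field_simps power2_eq_square)
  finally show ?thesis .
qed

section \<open>Coefficients and values of the Hamiltonian\<close>

lemma insertion_bisum:
  fixes P :: hpoly
  assumes "\<And>k v. k \<in> Poly_Mapping.keys P \<Longrightarrow> Poly_Mapping.lookup k v \<le> N"
  shows "insertion (point x y z w) P =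
    bisum N (\<lambda>a b. bisum N (\<lambda>m n. Poly_Mapping.lookup P (Abs_poly_mapping (point a b m n))) z w) x y"
proof -
  have lookup: "Poly_Mapping.lookup (Abs_poly_mapping (point a b m n)) = point a b m n" for a b m n :: nat
    by (rule lookup_Abs_poly_mapping) simp
  define e :: "nat \<times> nat \<times> nat \<times> nat \<Rightarrow> (coord \<Rightarrow>\<^sub>0 nat)" where "e = (\<lambda>(a, b, m, n). Abs_poly_mapping (point a b m n))"
  have inj: "inj e"
  proof (rule injI)
    fix i j assume "e i = e j"
    then have "point (fst i) (fst (snd i)) (fst (snd (snd i))) (snd (snd (snd i)))
      = point (fst j) (fst (snd j)) (fst (snd (snd j))) (snd (snd (snd j)))"
      unfolding e_def by (metis (no_types, lifting) case_prod_beta lookup)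
    from fun_cong[OF this, of CX] fun_cong[OF this, of CY] fun_cong[OF this, of CZ] fun_cong[OF this, of CW]
    show "i = j" by (simp add: prod_eq_iff)
  qed
  let ?S = "{..N} \<times> {..N} \<times> {..N} \<times> {..N}"
  have keys: "Poly_Mapping.keys P \<subseteq> e ` ?S"
  proof
    fix k assume k: "k \<in> Poly_Mapping.keys P"
    let ?l = "Poly_Mapping.lookup k"
    have "k = e (?l CX, ?l CY, ?l CZ, ?l CW)"
    proof (rule poly_mapping_eqI)
      fix v show "?l v = Poly_Mapping.lookup (e (?l CX, ?l CY, ?l CZ, ?l CW)) v"
        by (cases v) (simp_all add: e_def lookup)
    qed
    then show "k \<in> e ` ?S" using assms[OF k] by blast
  qed
  have "insertion (point x y z w) P
      = (\<Sum>k\<in>e ` ?S. Poly_Mapping.lookup P k * (\<Prod>v\<in>UNIV. point x y z w v ^ Poly_Mapping.lookup k v))"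
    by (rule eval_mpoly_superset[OF _ keys]) auto
  also have "\<dots> = (\<Sum>i\<in>?S. Poly_Mapping.lookup P (e i) * (\<Prod>v\<in>UNIV. point x y z w v ^ Poly_Mapping.lookup (e i) v))"
    by (rule sum.reindex_cong[OF inj_on_subset[OF inj]]) auto
  also have "\<dots> = (\<Sum>a\<le>N. \<Sum>b\<le>N. \<Sum>m\<le>N. \<Sum>n\<le>N.
      Poly_Mapping.lookup P (Abs_poly_mapping (point a b m n)) * (x ^ a * y ^ b * z ^ m * w ^ n))"
    by (simp add: sum.cartesian_product e_def case_prod_beta lookup UNIV_coord mult_ac)
  finally show ?thesis
    by (simp add: bisum_def sum_distrib_left mult_ac)
qed

text \<open>
  A nonzero polynomial does not vanish everywhere, because \<open>\<complex>(t)\<close> is infinite.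
\<close>

lemma insertion_injective:
  fixes P Q :: hpoly
  assumes "\<And>x y z w. insertion (point x y z w) P = insertion (point x y z w) Q"
  shows "P = Q"
proof -
  define R where "R = P - Q"
  define N where "N = (\<Sum>k\<in>Poly_Mapping.keys R. \<Sum>v\<in>UNIV. Poly_Mapping.lookup k v)"
  have N: "Poly_Mapping.lookup k v \<le> N" if "k \<in> Poly_Mapping.keys R" for k v
  proof -
    have "Poly_Mapping.lookup k v \<le> (\<Sum>v\<in>UNIV. Poly_Mapping.lookup k v)"
      by (rule member_le_sum) auto
    also have "\<dots> \<le> N" unfolding N_def by (rule member_le_sum) (use that in auto)
    finally show ?thesis .
  qed
  have zero: "bisum N (\<lambda>a b. bisum N (\<lambda>m n. Poly_Mapping.lookup R (Abs_poly_mapping (point a b m n))) z w) x y = 0" for x y z w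
  proof -
    have "insertion (point x y z w) R = 0" by (simp add: R_def insertion_hom assms)
    then show ?thesis using insertion_bisum[of R N x y z w] N by simp
  qed
  have "Poly_Mapping.lookup R k = 0" for k
  proof (rule ccontr)
    assume *: "Poly_Mapping.lookup R k \<noteq> 0"
    let ?l = "Poly_Mapping.lookup k"
    have le: "?l v \<le> N" for v using N[of k v] * by (simp add: in_keys_iff)
    have "point (?l CX) (?l CY) (?l CZ) (?l CW) = ?l" by (rule ext, case_tac x) simp_all
    moreover have "Poly_Mapping.lookup R (Abs_poly_mapping (point (?l CX) (?l CY) (?l CZ) (?l CW))) = 0"
      by (rule bisum_eq_0D[OF bisum_eq_0D[OF zero le le] le le])
    ultimately show False using * by (simp add: lookup_inverse)
  qed
  then have "R = 0" by (intro poly_mapping_eqI) simp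
  then show ?thesis by (simp add: R_def)
qed

lemma bipolynomial_insertion:
  assumes "\<And>v. bipolynomial (\<lambda>x y. f x y v)"
  shows "bipolynomial (\<lambda>x y. insertion (f x y) K)"
proof (induction K rule: mpoly_induct)
  case 0
  show ?case by (simp add: insertion_hom bipolynomial_const)
next
  case (add K m c)
  then show ?case
    unfolding insertion_hom eval_mpoly_single[of "\<lambda>c. c", OF refl] UNIV_coord
    by (simp, intro bipolynomial_add bipolynomial_mult bipolynomial_const bipolynomial_power assms)
qed

lemma bipolynomial_slice:
  "bipolynomial (\<lambda>x y. insertion (point x y z w) K + c)"
  "bipolynomial (\<lambda>z w. insertion (point x y z w) K + c)"
  "bipolynomial (\<lambda>y x. insertion (point x y z w) K + c)"
proof -
  note intros = bipolynomial_add bipolynomial_insertion bipolynomial_const bipolynomial_fst bipolynomial_snd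
  show "bipolynomial (\<lambda>x y. insertion (point x y z w) K + c)"
    by (intro intros, case_tac v) (simp_all add: intros)
  show "bipolynomial (\<lambda>z w. insertion (point x y z w) K + c)"
    by (intro intros, case_tac v) (simp_all add: intros)
  show "bipolynomial (\<lambda>y x. insertion (point x y z w) K + c)"
    by (intro intros, case_tac v) (simp_all add: intros)
qed

theorem theorem3p2:
  fixes \<alpha>0 \<alpha>1 \<alpha>2 \<alpha>3 \<alpha>4 :: complex and H :: hpoly
  assumes params: "\<alpha>0 + \<alpha>1 + 2 * \<alpha>2 + 2 * \<alpha>3 + 2 * \<alpha>4 = 1"
    and A1: "total_degree H \<le> 6"
    and A2_0: "becomes_polynomial_Hamiltonian H (1 / X) (- (((Y - 1) * X + C \<alpha>0) * X)) Z W"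
    and A2_1: "becomes_polynomial_Hamiltonian H (1 / X) (- ((Y * X + C \<alpha>1) * X)) Z W"
    and A2_2: "becomes_polynomial_Hamiltonian H (- (((X - Z) * Y - C \<alpha>2) * Y)) (1 / Y) Z (W + Y)"
    and A2_3: "becomes_polynomial_Hamiltonian H X Y (1 / Z) (- ((W * Z + C \<alpha>3) * Z))"
    and A2_4: "becomes_polynomial_Hamiltonian H X Y Z (W - 2 * C \<alpha>4 / Z + T / Z ^ 2)"
  shows "to_fract (mpderiv CY H) =
           (2 * X ^ 2 * Y - X ^ 2 + (C \<alpha>0 + C \<alpha>1) * X + 2 * C \<alpha>3 * Z + 2 * Z ^ 2 * W) / T + 1
       \<and> - to_fract (mpderiv CX H) =
           (- 2 * X * Y ^ 2 + 2 * X * Y - (C \<alpha>0 + C \<alpha>1) * Y + C \<alpha>1) / T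
       \<and> to_fract (mpderiv CW H) =
           (2 * Z ^ 2 * W - Z ^ 2 + (C \<alpha>0 + C \<alpha>1 + 2 * C \<alpha>2 + 2 * C \<alpha>3) * Z + 2 * Y * Z ^ 2) / T + 1
       \<and> - to_fract (mpderiv CZ H) =
           (- 2 * Z * W ^ 2 + 2 * Z * W - (C \<alpha>0 + C \<alpha>1 + 2 * C \<alpha>2 + 2 * C \<alpha>3) * W
              - 2 * C \<alpha>3 * Y - 4 * Y * Z * W + C \<alpha>3) / T"
proof -
  define A :: "complex \<Rightarrow> Ct" where "A \<alpha> = to_fract [:\<alpha>:]" for \<alpha>
  define t :: Ct where "t = to_fract [:0, 1:]"
  have t: "t \<noteq> 0" by (simp add: t_def)
  have "A (\<alpha>0 + \<alpha>1 + 2 * \<alpha>2 + 2 * \<alpha>3 + 2 * \<alpha>4) = 1"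
    unfolding params by (simp add: A_def to_fract_constant_1)
  moreover have A_add: "A (a + b) = A a + A b" for a b
    by (simp add: A_def flip: to_fract_add)
  moreover have "A (2 * a) = 2 * A a" for a unfolding mult_2 by (rule A_add)
  ultimately have paramsA: "A \<alpha>0 + A \<alpha>1 + 2 * A \<alpha>2 + 2 * A \<alpha>3 + 2 * A \<alpha>4 = 1" by simp
  define h where "h a b m n = Poly_Mapping.lookup H (Abs_poly_mapping (point a b m n))" for a b m n
  have degree_le: "(\<Sum>v\<in>UNIV. Poly_Mapping.lookup k v) \<le> 6" if "k \<in> Poly_Mapping.keys H" for k
  proof -
    have "(\<Sum>v\<in>UNIV. Poly_Mapping.lookup k v) \<le> total_degree H"
      unfolding total_degree_def by (rule Max_ge) (use that in auto)
    then show ?thesis using A1 by simp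
  qed
  have le6: "Poly_Mapping.lookup k v \<le> 6" if "k \<in> Poly_Mapping.keys H" for k v
    using member_le_sum[of v UNIV "Poly_Mapping.lookup k"] degree_le[OF that] by auto
  have deg: "h a b m n = 0" if "a + b + m + n > 6" for a b m n
  proof (rule ccontr)
    assume "h a b m n \<noteq> 0"
    then have "Abs_poly_mapping (point a b m n) \<in> Poly_Mapping.keys H"
      by (simp add: h_def in_keys_iff)
    from degree_le[OF this] show False using that by (simp add: UNIV_coord)
  qed
  have val: "insertion (point x y z w) H = bisum 6 (\<lambda>a b. bisum 6 (h a b) z w) x y" for x y z w
    unfolding h_def by (rule insertion_bisum) (rule le6)
  have r0: "chart_regular (A \<alpha>0) (\<lambda>x y. bisum 6 (\<lambda>a b. bisum 6 (h a b) z w) x (y + 1))" for z w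
  proof -
    obtain K c where "\<And>x y z w. x \<noteq> 0 \<Longrightarrow> insertion (point x y z w) H
        = insertion (point (1 / x) (- (((y - 1) * x + A \<alpha>0) * x)) z w) K + c"
      using hamiltonian_in_chart_0[OF A2_0] unfolding A_def by blast
    from this[of _ "_ + 1"] show ?thesis
      unfolding chart_regular_def val[symmetric] by (intro exI[of _ "\<lambda>x y. insertion (point x y z w) K + c"] conjI bipolynomial_slice) simp
  qed
  have r1: "chart_regular (A \<alpha>1) (bisum 6 (\<lambda>a b. bisum 6 (h a b) z w))" for z w
  proof -
    obtain K c where "\<And>x y z w. x \<noteq> 0 \<Longrightarrow> insertion (point x y z w) H
        = insertion (point (1 / x) (- ((y * x + A \<alpha>1) * x)) z w) K + c"
      using hamiltonian_in_chart_1[OF A2_1] unfolding A_def by blast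
    then show ?thesis
      unfolding chart_regular_def val[symmetric] by (intro exI[of _ "\<lambda>x y. insertion (point x y z w) K + c"] conjI bipolynomial_slice) simp
  qed
  have r2: "chart_regular (- A \<alpha>2) (\<lambda>y u. bisum 6 (\<lambda>a b. bisum 6 (h a b) z (v - y)) (u + z) y)" for z v
  proof -
    obtain K c where "\<And>x y z w. y \<noteq> 0 \<Longrightarrow> insertion (point x y z w) H
        = insertion (point (- (((x - z) * y - A \<alpha>2) * y)) (1 / y) z (w + y)) K + c"
      using hamiltonian_in_chart_2[OF A2_2] unfolding A_def by blast
    then show ?thesis
      unfolding chart_regular_def val[symmetric] by (intro exI[of _ "\<lambda>y x. insertion (point x y z v) K + c"] conjI bipolynomial_slice) simp
  qed
  have r3: "chart_regular (A \<alpha>3) (\<lambda>z w. bisum 6 (\<lambda>a b. bisum 6 (h a b) z w) x y)" for x y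
  proof -
    obtain K c where "\<And>x y z w. z \<noteq> 0 \<Longrightarrow> insertion (point x y z w) H
        = insertion (point x y (1 / z) (- ((w * z + A \<alpha>3) * z))) K + c"
      using hamiltonian_in_chart_3[OF A2_3] unfolding A_def by blast
    then show ?thesis
      unfolding chart_regular_def val[symmetric] by (intro exI[of _ "\<lambda>z w. insertion (point x y z w) K + c"] conjI bipolynomial_slice) simp
  qed
  have r4: "\<exists>K. bipolynomial K \<and> (\<forall>z s. z \<noteq> 0 \<longrightarrow>
      bisum 6 (\<lambda>a b. bisum 6 (h a b) z (s + 2 * A \<alpha>4 / z - t / z\<^sup>2)) x y + 1 / z = K z s)" for x y
  proof -
    obtain K c where "\<And>x y z w. z \<noteq> 0 \<Longrightarrow> insertion (point x y z w) H + 1 / z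
        = insertion (point x y z (w - 2 * A \<alpha>4 / z + t / z ^ 2)) K + c"
      using hamiltonian_in_chart_4[OF A2_4] unfolding A_def t_def by blast
    then show ?thesis
      unfolding val[symmetric] by (intro exI[of _ "\<lambda>z w. insertion (point x y z w) K + c"] conjI bipolynomial_slice) simp
  qed
  have "\<exists>l. \<forall>x y z w. bisum 6 (\<lambda>a b. bisum 6 (h a b) z w) x y =
     (x\<^sup>2 * y\<^sup>2 - x\<^sup>2 * y + (A \<alpha>0 + A \<alpha>1) * x * y - A \<alpha>1 * x
     + z\<^sup>2 * w\<^sup>2 - z\<^sup>2 * w + (1 - 2 * A \<alpha>4) * z * w - A \<alpha>3 * z
     + 2 * y * z\<^sup>2 * w + 2 * A \<alpha>3 * y * z) / t + y + w + l"
    (is "\<exists>l. \<forall>x y z w. ?N x y z w = ?E l x y z w")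
  proof (rule normal_form_if_charts[OF deg t r0 r1 r3 r4])
    fix c a0 a1 b0 b1 b2 q0 q1 q2 q3 e s0 s1 s2 k0 k1 k2 k3 k4 k5 l0 l1 l2 l3 l4 l5 l6
    assume "?N x y z w = normal_form t (A \<alpha>3) (A \<alpha>4) c [:a0, a1:] [:b0, b1, b2:] [:q0, q1, q2, q3:] e
        [:s0, s1, s2:] [:k0, k1, k2, k3, k4, k5:] [:l0, l1, l2, l3, l4, l5, l6:] x y z w" for x y z w
    then have "?N = normal_form t (A \<alpha>3) (A \<alpha>4) c [:a0, a1:] [:b0, b1, b2:] [:q0, q1, q2, q3:] e
        [:s0, s1, s2:] [:k0, k1, k2, k3, k4, k5:] [:l0, l1, l2, l3, l4, l5, l6:]" by (intro ext)
    moreover assume "k0 = - (A \<alpha>1 * s0)" "k0 + k1 + k2 + k3 + k4 + k5 = A \<alpha>0 * (s0 + s1 + s2)"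
    ultimately have "?N x y z w = ?E l0 x y z w" for x y z w
      by (rule normal_form_unique[OF paramsA t, where N = ?N]) (rule r2)
    then show ?thesis by blast
  qed
  then obtain l where H_val: "insertion (point x y z w) H =
     (x\<^sup>2 * y\<^sup>2 - x\<^sup>2 * y + (A \<alpha>0 + A \<alpha>1) * x * y - A \<alpha>1 * x
     + z\<^sup>2 * w\<^sup>2 - z\<^sup>2 * w + (1 - 2 * A \<alpha>4) * z * w - A \<alpha>3 * z
     + 2 * y * z\<^sup>2 * w + 2 * A \<alpha>3 * y * z) / t + y + w + l" for x y z w
    unfolding val by blast
  define k :: "Ct \<Rightarrow> hpoly" where "k = Poly_Mapping.single 0"
  define g :: "coord \<Rightarrow> hpoly" where "g v = Poly_Mapping.single (Poly_Mapping.single v 1) 1" for v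
  define E where "E = (let x = g CX; y = g CY; z = g CZ; w = g CW in
     k (1 / t) * (x * x * y * y - x * x * y + k (A \<alpha>0 + A \<alpha>1) * x * y - k (A \<alpha>1) * x
     + z * z * w * w - z * z * w + k (1 - 2 * A \<alpha>4) * z * w - k (A \<alpha>3) * z
     + k 2 * y * z * z * w + k (2 * A \<alpha>3) * y * z) + y + w + k l)"
  have "insertion (point x y z w) E = insertion (point x y z w) H" for x y z w
    unfolding H_val using insertion_hom(6)[of "point x y z w" 2] by (simp add: E_def k_def g_def Let_def insertion_hom insertion_hom(7)[unfolded One_nat_def] power2_eq_square)
  then have "E = H" by (rule insertion_injective)
  have coef: "to_fract (k c) = coef c" and gen: "to_fract (g v) = gen v" for c v
    by (simp_all add: k_def g_def coef_def gen_def)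
  have C: "coef (A \<alpha>) = C \<alpha>" for \<alpha> by (simp add: A_def C_def)
  have coef2: "coef 2 = 2" using coef_hom(3)[of 1 1] by (simp add: coef_hom)
  have T: "coef t = T" by (simp add: t_def T_def)
  have T1: "T * coef (1 / t) = 1" unfolding T[symmetric] coef_hom(4)[symmetric] using t by (simp add: coef_hom)
  then have "T \<noteq> 0" by auto
  then have T': "coef (1 / t) = 1 / T" using T1 by (simp add: nonzero_eq_divide_eq mult.commute)
  have "to_fract H = (X * X * Y * Y - X * X * Y + (C \<alpha>0 + C \<alpha>1) * X * Y - C \<alpha>1 * X
     + Z * Z * W * W - Z * Z * W + (1 - 2 * C \<alpha>4) * Z * W - C \<alpha>3 * Z
     + 2 * Y * Z * Z * W + 2 * C \<alpha>3 * Y * Z) / T + Y + W + coef l"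
    unfolding \<open>E = H\<close>[symmetric] E_def Let_def
    by (simp add: coef gen coef_hom coef_diff coef2 C T')
  then have mp: "to_fract (mpderiv v H) = partial v ((X * X * Y * Y - X * X * Y + (C \<alpha>0 + C \<alpha>1) * X * Y - C \<alpha>1 * X
     + Z * Z * W * W - Z * Z * W + (1 - 2 * C \<alpha>4) * Z * W - C \<alpha>3 * Z
     + 2 * Y * Z * Z * W + 2 * C \<alpha>3 * Y * Z) / T + Y + W + coef l)" for v
    unfolding partial_to_fract[symmetric] by simp
  have p4: "1 - 2 * C \<alpha>4 = C \<alpha>0 + C \<alpha>1 + 2 * C \<alpha>2 + 2 * C \<alpha>3"
    using arg_cong[OF paramsA, of coef] by (simp add: coef_hom coef2 C algebra_simps)
  show ?thesis
    unfolding mp p4 using \<open>T \<noteq> 0\<close>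
    by (simp add: partial_simps partial_coef) (simp add: field_simps power2_eq_square)
qed

end
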